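(* Let $\phi:\mathbb{N}\to\mathbb{R}_+$ be non-decreasing with $\phi(n)/\log n\to\infty$ as $n\to\infty$. Let $\Lambda$ be the set of irrational $x\in[0,1)$ whose partial quotients $\{a_n(x)\}_{n\ge1}$ are non-decreasing and satisfy $a_n(x)\to\infty$, and let $$E_\phi:=\Big\{x\in\Lambda:\liminf_{n\to\infty}\frac{\log a_n(x)}{\phi(n)}=1\Big\}.$$ Define $B\in[1,\infty]$ by $\log B:=\limsup_{n\to\infty}\frac{\log\phi(n)}{n}$. Then $\dim_{\rm H}E_\phi=\frac{1}{B+1}$ (interpreted as $0$ when $B=\infty$).
   Context: For irrational $x\in[0,1)$, $x=[a_1(x),a_2(x),\dots]$ denotes its continued fraction expansion with positive integer partial quotients $a_n(x)$. $\dim_{\rm H}$ denotes Hausdorff dimension. *)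

theory Defs
  imports "HOL-Analysis.Analysis"
begin

subsection \<open>Regular continued fractions\<close>

text \<open>
  Complete quotients: \<^term>\<open>x\<close> itself, then repeatedly the reciprocal of the fractional part.  For
  irrational \<^term>\<open>x\<close> the process never meets an integer, so no division by zero occurs, and
  \<^term>\<open>x\<close> has the infinite expansion \<open>[a\<^sub>0; a\<^sub>1, a\<^sub>2, \<dots>]\<close> with \<open>a\<^sub>n\<close> the floor of the \<open>n\<close>-th
  complete quotient.  For \<open>x \<in> [0,1)\<close> one has \<open>a\<^sub>0 = 0\<close>, and \<open>x = [a\<^sub>1, a\<^sub>2, \<dots>]\<close>;
  only the indices \<open>n \<ge> 1\<close> are partial quotients in that notation.
\<close>

primrec complete_quotient :: "real \<Rightarrow> nat \<Rightarrow> real" where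
  "complete_quotient x 0 = x"
| "complete_quotient x (Suc n) = 1 / frac (complete_quotient x n)"

definition partial_quotient :: "real \<Rightarrow> nat \<Rightarrow> int" where
  "partial_quotient x n = \<lfloor>complete_quotient x n\<rfloor>"

lemma complete_quotient_irrational:
  assumes "x \<notin> \<rat>"
  shows "complete_quotient x n \<notin> \<rat>"
proof (induction n)
  case 0
  show ?case using assms by simp
next
  case (Suc n)
  let ?y = "complete_quotient x n"
  have "frac ?y \<notin> \<rat>"
  proof
    assume "frac ?y \<in> \<rat>"
    then have "frac ?y + of_int \<lfloor>?y\<rfloor> \<in> \<rat>" by (intro Rats_add Rats_of_int)
    with Suc show False by (simp add: frac_def)
  qed
  moreover have "frac ?y = 1 / (1 / frac ?y)" by simp
  ultimately have "1 / frac ?y \<notin> \<rat>" by (metis Rats_1 Rats_divide)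
  then show ?case by simp
qed

lemma partial_quotient_pos:
  assumes "x \<notin> \<rat>" "n \<ge> 1"
  shows "partial_quotient x n \<ge> 1"
proof -
  obtain m where n: "n = Suc m" using assms(2) by (cases n) auto
  let ?y = "complete_quotient x m"
  have "?y \<notin> \<int>" using complete_quotient_irrational[OF assms(1)] Ints_subset_Rats by blast
  then have "frac ?y > 0" by simp
  then have "1 / frac ?y \<ge> 1" using frac_lt_1[of ?y] by simp
  then show ?thesis by (simp add: partial_quotient_def n)
qed

subsection \<open>Hausdorff dimension\<close>

text \<open>
  \<open>(diam U)\<^sup>s\<close> with the conventions \<open>(diam {})\<^sup>s = 0\<close> and \<open>(diam U)\<^sup>0 = 1\<close> for nonempty \<open>U\<close>.
  The case \<open>s = 0\<close> has to be separated because \<^prop>\<open>(0::real) powr 0 = 0\<close>.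
\<close>

definition diam_pow :: "real \<Rightarrow> 'a::metric_space set \<Rightarrow> ennreal" where
  "diam_pow s U = (if U = {} then 0 else if s = 0 then 1 else ennreal (diameter U powr s))"

text \<open>
  Covers are required to be bounded because \<^const>\<open>diameter\<close> is real-valued and carries no
  information about unbounded sets.
\<close>

definition hausdorff_premeasure :: "real \<Rightarrow> real \<Rightarrow> 'a::metric_space set \<Rightarrow> ennreal" where
  "hausdorff_premeasure s \<delta> A =
     (INF U \<in> {U :: nat \<Rightarrow> 'a set. A \<subseteq> (\<Union>i. U i) \<and> (\<forall>i. bounded (U i) \<and> diameter (U i) \<le> \<delta>)}.
        \<Sum>i. diam_pow s (U i))"

definition hausdorff_measure :: "real \<Rightarrow> 'a::metric_space set \<Rightarrow> ennreal" where
  "hausdorff_measure s A = (SUP \<delta> \<in> {0<..}. hausdorff_premeasure s \<delta> A)"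

definition hausdorff_dim :: "'a::metric_space set \<Rightarrow> ereal" where
  "hausdorff_dim A = Inf {ereal s | s. 0 \<le> s \<and> hausdorff_measure s A = 0}"

subsection \<open>The sets under consideration\<close>

definition Lambda_set :: "real set" where
  "Lambda_set = {x. 0 \<le> x \<and> x < 1 \<and> x \<notin> \<rat> \<and>
     mono_on {1..} (partial_quotient x) \<and>
     filterlim (partial_quotient x) at_top sequentially}"

definition E_set :: "(nat \<Rightarrow> real) \<Rightarrow> real set" where
  "E_set \<phi> = {x \<in> Lambda_set.
     liminf (\<lambda>n. ereal (ln (real_of_int (partial_quotient x n)) / \<phi> n)) = 1}"

definition ln_ereal :: "ereal \<Rightarrow> ereal" where
  "ln_ereal b = (if b = \<infinity> then \<infinity> else if b \<le> 0 then - \<infinity> else ereal (ln (real_of_ereal b)))"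

lemma ln_ereal_bij: "bij_betw ln_ereal {1..} {0..}"
proof (rule bij_betw_byWitness[where f' = "\<lambda>l. if l = \<infinity> then \<infinity> else ereal (exp (real_of_ereal l))"])
  have *: "\<exists>r\<ge>c. b = ereal r" if "ereal c \<le> b" "b \<noteq> \<infinity>" for b c
    using that by (cases b) auto
  show "\<forall>b\<in>{1..}. (if ln_ereal b = \<infinity> then \<infinity> else ereal (exp (real_of_ereal (ln_ereal b)))) = b"
    using *[of 1] by (force simp: ln_ereal_def one_ereal_def)
  show "\<forall>l\<in>{0..}. ln_ereal (if l = \<infinity> then \<infinity> else ereal (exp (real_of_ereal l))) = l"
    using *[of 0] by (force simp: ln_ereal_def zero_ereal_def)
  show "ln_ereal ` {1..} \<subseteq> {0..}"
    using *[of 1] by (force simp: ln_ereal_def one_ereal_def zero_ereal_def)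
  show "(\<lambda>l. if l = \<infinity> then \<infinity> else ereal (exp (real_of_ereal l))) ` {0..} \<subseteq> {1..}"
    using *[of 0] by (force simp: one_ereal_def zero_ereal_def)
qed

end

theory Submission
  imports Defs "HOL-Probability.Infinite_Product_Measure"
begin

text \<open>
  If \<open>x\<close> and \<open>y\<close> share their first \<open>n\<close> partial quotients and have complete quotients \<open>X\<^sub>k\<close>, \<open>Y\<^sub>k\<close>, then
  \<open>\<bar>x - y\<bar> = \<bar>X\<^bsub>n+1\<^esub> - Y\<^bsub>n+1\<^esub>\<bar> / (X\<^sub>1 Y\<^sub>1 \<dots> X\<^bsub>n+1\<^esub> Y\<^bsub>n+1\<^esub>)\<close>; all diameter estimates come from this identity.

  Upper bound: if \<open>1 < c < B\<close>, every \<open>x\<close> in the set satisfies \<open>a\<^bsub>n+1\<^esub> \<ge> (a\<^sub>1 \<dots> a\<^sub>n)\<^bsup>c-1\<^esup>\<close> for infinitely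
  many \<open>n\<close>, since otherwise \<open>ln (a\<^sub>1 \<dots> a\<^sub>n)\<close>, and hence \<open>\<phi> n\<close>, would be \<open>O(c\<^sup>n)\<close>.  The corresponding part
  of a cylinder has diameter at most \<open>(a\<^sub>1 \<dots> a\<^sub>n)\<^bsup>-(c+1)\<^esup>\<close>, and for \<open>(c + 1) s > 1\<close> the \<open>s\<close>-th powers of
  these diameters decay geometrically in \<open>n\<close> once the digits are large, which \<open>a\<^sub>n \<rightarrow> \<infinity>\<close> guarantees.
  The case \<open>c = 1\<close> is the covering by full cylinders.

  Lower bound: for \<open>b > B\<close> the regularisation \<open>\<psi> n = sup\<^sub>j \<phi> (n + j) / b\<^sup>j\<close> dominates \<open>\<phi>\<close>, agrees with it
  infinitely often and satisfies \<open>\<psi> (n + 1) \<le> b \<psi> n\<close>.  With \<open>m\<^sub>n = \<lfloor>exp (\<psi> n)\<rfloor>\<close>, every choice of digits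
  \<open>n m\<^sub>n \<le> a\<^sub>n < (n + 1) m\<^sub>n\<close> is automatically non-decreasing and gives a point of the set; the uniform
  product measure on these choices yields dimension at least \<open>1 / (b + 1)\<close> by mass distribution.
\<close>

subsection \<open>Hausdorff measure\<close>

lemma hausdorff_premeasure_le_cover:
  fixes U :: "'i::countable \<Rightarrow> 'a::metric_space set"
  assumes "A \<subseteq> (\<Union>i. U i)" "\<And>i. bounded (U i)" "\<And>i. diameter (U i) \<le> \<delta>" "\<delta> > 0"
  shows "hausdorff_premeasure s \<delta> A \<le> (\<integral>\<^sup>+i. diam_pow s (U i) \<partial>count_space UNIV)"
proof -
  define V where "V k = (if k \<in> range (to_nat :: 'i \<Rightarrow> nat) then U (from_nat k) else {})" for k
  have cover: "A \<subseteq> (\<Union>k. V k)"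
  proof
    fix x assume "x \<in> A"
    then obtain i where "x \<in> U i" using assms(1) by auto
    then have "x \<in> V (to_nat i)" by (simp add: V_def)
    then show "x \<in> (\<Union>k. V k)" by blast
  qed
  have "hausdorff_premeasure s \<delta> A \<le> (\<Sum>k. diam_pow s (V k))"
    unfolding hausdorff_premeasure_def
    using assms cover by (intro INF_lower) (auto simp: V_def diameter_empty)
  also have "\<dots> = (\<integral>\<^sup>+k. diam_pow s (V k) \<partial>count_space UNIV)"
    by (simp add: nn_integral_count_space_nat)
  also have "\<dots> = (\<integral>\<^sup>+k. diam_pow s (V k) * indicator (range (to_nat :: 'i \<Rightarrow> nat)) k \<partial>count_space UNIV)"
    by (intro nn_integral_cong) (auto simp: V_def diam_pow_def indicator_def)
  also have "\<dots> = (\<integral>\<^sup>+k. diam_pow s (V k) \<partial>count_space (range (to_nat :: 'i \<Rightarrow> nat)))"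
    by (simp add: nn_integral_count_space_indicator)
  also have "\<dots> = (\<integral>\<^sup>+i. diam_pow s (V (to_nat i)) \<partial>count_space (UNIV :: 'i set))"
    by (rule nn_integral_bij_count_space[symmetric]) (auto simp: bij_betw_def inj_to_nat)
  also have "\<dots> = (\<integral>\<^sup>+i. diam_pow s (U i) \<partial>count_space UNIV)"
    by (simp add: V_def)
  finally show ?thesis .
qed

text \<open>For \<open>s > 0\<close> a small total already forces every diameter to be small, so a
  single family of covers serves all scales at once.\<close>

lemma hausdorff_measure_eq_0I:
  fixes A :: "'a::metric_space set"
  assumes "s > 0"
    and cover: "\<And>e. e > 0 \<Longrightarrow> \<exists>U :: 'i::countable \<Rightarrow> 'a set.
      A \<subseteq> (\<Union>i. U i) \<and> (\<forall>i. bounded (U i)) \<and>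
      (\<integral>\<^sup>+i. diam_pow s (U i) \<partial>count_space UNIV) \<le> ennreal e"
  shows "hausdorff_measure s A = 0"
proof -
  have "hausdorff_premeasure s \<delta> A \<le> 0" if "\<delta> > 0" for \<delta>
  proof (rule ennreal_le_epsilon)
    fix e :: real assume "e > 0"
    \<comment> \<open>Each term is at most the total, so a total of at most
      \<open>\<delta> powr s\<close> keeps every diameter at most \<open>\<delta>\<close>.\<close>
    define e' where "e' = min e (\<delta> powr s)"
    have "e' > 0" using \<open>e > 0\<close> that by (simp add: e'_def)
    then obtain U :: "'i \<Rightarrow> 'a set" where U: "A \<subseteq> (\<Union>i. U i)" "\<And>i. bounded (U i)"
      "(\<integral>\<^sup>+i. diam_pow s (U i) \<partial>count_space UNIV) \<le> ennreal e'"
      using cover by blast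
    have "diameter (U i) \<le> \<delta>" for i
    proof (cases "U i = {}")
      case False
      have "diam_pow s (U i) \<le> ennreal e'"
        using nn_integral_ge_point[of i UNIV "\<lambda>i. diam_pow s (U i)"] U(3) by auto
      then have "diameter (U i) powr s \<le> \<delta> powr s"
        using False \<open>s > 0\<close> \<open>e' > 0\<close> by (simp add: diam_pow_def e'_def)
      then show ?thesis
        using \<open>s > 0\<close> that by (meson less_eq_real_def not_le powr_less_mono2)
    qed (use that in \<open>simp add: diameter_def\<close>)
    then have "hausdorff_premeasure s \<delta> A \<le> (\<integral>\<^sup>+i. diam_pow s (U i) \<partial>count_space UNIV)"
      using U that by (intro hausdorff_premeasure_le_cover)
    also have "\<dots> \<le> ennreal e" using U(3) by (rule order_trans) (simp add: e'_def ennreal_leI)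
    finally show "hausdorff_premeasure s \<delta> A \<le> 0 + ennreal e" by simp
  qed
  then show ?thesis
    unfolding hausdorff_measure_def by (auto intro!: antisym SUP_least)
qed

lemma hausdorff_measure_0_cover:
  assumes "hausdorff_measure s A = 0" "e > 0"
  obtains U :: "nat \<Rightarrow> 'a::metric_space set"
  where "A \<subseteq> (\<Union>i. U i)" "\<And>i. bounded (U i)" "(\<Sum>i. diam_pow s (U i)) < e"
proof -
  have "hausdorff_premeasure s 1 A \<le> hausdorff_measure s A"
    unfolding hausdorff_measure_def by (intro SUP_upper) auto
  then have "hausdorff_premeasure s 1 A < e" using assms by simp
  then show ?thesis
    unfolding hausdorff_premeasure_def INF_less_iff using that by blast
qed

text \<open>The cover of \<open>A i\<close> gets the budget \<open>e / 2^(i+1)\<close>, and all of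
  them together form a cover indexed by pairs.\<close>

lemma hausdorff_measure_UN_eq_0:
  fixes A :: "nat \<Rightarrow> 'a::metric_space set"
  assumes "s > 0" and null: "\<And>i. hausdorff_measure s (A i) = 0"
  shows "hausdorff_measure s (\<Union>i. A i) = 0"
proof (rule hausdorff_measure_eq_0I[OF \<open>s > 0\<close>])
  fix e :: real assume "e > 0"
  have "\<exists>U :: nat \<Rightarrow> 'a set. A i \<subseteq> (\<Union>k. U k) \<and> (\<forall>k. bounded (U k)) \<and>
      (\<Sum>k. diam_pow s (U k)) < ennreal (e * (1/2)^Suc i)" for i
  proof -
    have "ennreal (e * (1/2)^Suc i) > 0" using \<open>e > 0\<close> by simp
    then show ?thesis by (rule hausdorff_measure_0_cover[OF null[of i]]) blast
  qed
  then obtain U :: "nat \<Rightarrow> nat \<Rightarrow> 'a set" where U: "\<And>i. A i \<subseteq> (\<Union>k. U i k)" "\<And>i k. bounded (U i k)"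
    "\<And>i. (\<Sum>k. diam_pow s (U i k)) < ennreal (e * (1/2)^Suc i)"
    by metis
  have "(\<integral>\<^sup>+p. diam_pow s (case_prod U p) \<partial>count_space UNIV)
      = (\<integral>\<^sup>+i. \<integral>\<^sup>+k. diam_pow s (U i k) \<partial>count_space UNIV \<partial>count_space UNIV)"
    by (simp add: nn_integral_fst_count_space[symmetric])
  also have "\<dots> = (\<Sum>i. \<Sum>k. diam_pow s (U i k))"
    by (simp add: nn_integral_count_space_nat)
  also have "\<dots> \<le> (\<Sum>i. ennreal (e * (1/2)^Suc i))"
    using U(3) by (intro suminf_le) (auto intro: less_imp_le)
  also have "\<dots> = ennreal e"
    using sums_mult[OF power_half_series, of e] \<open>e > 0\<close> by (intro suminf_ennreal_eq) auto
  finally have le: "(\<integral>\<^sup>+p. diam_pow s (case_prod U p) \<partial>count_space UNIV) \<le> ennreal e" .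
  have "(\<Union>i. A i) \<subseteq> (\<Union>p. case_prod U p)" "\<forall>p. bounded (case_prod U p)"
    using U(1,2) by fastforce+
  with le show "\<exists>V :: nat \<times> nat \<Rightarrow> 'a set. (\<Union>i. A i) \<subseteq> (\<Union>p. V p) \<and> (\<forall>p. bounded (V p)) \<and>
      (\<integral>\<^sup>+p. diam_pow s (V p) \<partial>count_space UNIV) \<le> ennreal e"
    by blast
qed

lemma hausdorff_measure_mono:
  assumes "A \<subseteq> B"
  shows "hausdorff_measure s A \<le> hausdorff_measure s B"
  unfolding hausdorff_measure_def hausdorff_premeasure_def
  using assms by (intro SUP_mono' INF_superset_mono) auto

text \<open>Mass distribution principle with the mass on a parameter space: a cover of
  \<open>A\<close> pulls back to one of \<open>space M\<close>, whose mass is then at most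
  \<open>C\<close> times the cost of the cover. Preimages only have to lie in measurable sets
  \<open>S\<close>, so \<open>g\<close> may come from a choice.\<close>

lemma mass_distribution:
  fixes A :: "'a::metric_space set" and g :: "'w \<Rightarrow> 'a"
  assumes "emeasure M (space M) > 0" and "C < top"
    and g: "g ` space M \<subseteq> A"
    and bound: "\<And>U. bounded U \<Longrightarrow> \<exists>S\<in>sets M. {w \<in> space M. g w \<in> U} \<subseteq> S \<and> emeasure M S \<le> C * diam_pow s U"
  shows "hausdorff_measure s A > 0"
proof (rule ccontr)
  assume "\<not> hausdorff_measure s A > 0"
  then have null: "hausdorff_measure s A = 0" by (simp add: not_gr_zero)
  have "emeasure M (space M) \<le> C * e" if e: "e > 0" for e
  proof -
    obtain U :: "nat \<Rightarrow> 'a set" where U: "A \<subseteq> (\<Union>i. U i)" "\<And>i. bounded (U i)"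
      "(\<Sum>i. diam_pow s (U i)) < e"
      using hausdorff_measure_0_cover[OF null e] by metis
    have "\<forall>i. \<exists>S. S \<in> sets M \<and> {w \<in> space M. g w \<in> U i} \<subseteq> S \<and> emeasure M S \<le> C * diam_pow s (U i)"
      using bound U(2) by blast
    then obtain S where S: "\<And>i. S i \<in> sets M" "\<And>i. {w \<in> space M. g w \<in> U i} \<subseteq> S i"
      "\<And>i. emeasure M (S i) \<le> C * diam_pow s (U i)"
      by metis
    have "emeasure M (space M) \<le> emeasure M (\<Union>i. S i)"
    proof (intro emeasure_mono subsetI)
      fix w assume w: "w \<in> space M"
      then obtain i where "g w \<in> U i" using g U(1) by blast
      with w S(2) show "w \<in> (\<Union>i. S i)" by blast
    qed (use S(1) in auto)
    also have "\<dots> \<le> (\<Sum>i. emeasure M (S i))"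
      using S(1) by (intro emeasure_subadditive_countably) auto
    also have "\<dots> \<le> (\<Sum>i. C * diam_pow s (U i))"
      by (intro suminf_le S(3)) auto
    also have "\<dots> = C * (\<Sum>i. diam_pow s (U i))" by simp
    also have "\<dots> \<le> C * e" using U(3) by (intro mult_left_mono) auto
    finally show ?thesis .
  qed
  moreover obtain c where c: "C = ennreal c" "c \<ge> 0"
    using \<open>C < top\<close> by (cases C) auto
  ultimately have "emeasure M (space M) \<le> 0 + ennreal e" if "e > 0" for e
  proof -
    \<comment> \<open>Dividing by \<open>c + 1\<close> instead of \<open>c\<close> also covers
      \<open>c = 0\<close>.\<close>
    have "emeasure M (space M) \<le> C * ennreal (e / (c + 1))"
      using that c \<open>\<And>e. e > 0 \<Longrightarrow> emeasure M (space M) \<le> C * e\<close> by simp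
    also have "\<dots> = ennreal (c * (e / (c + 1)))" using c that by (simp add: ennreal_mult[symmetric])
    also have "\<dots> \<le> ennreal e" using c that by (intro ennreal_leI) (simp add: field_simps)
    finally show ?thesis by simp
  qed
  then have "emeasure M (space M) \<le> 0" using ennreal_le_epsilon[of 0] by blast
  with assms(1) show False by simp
qed

lemma hausdorff_dim_leI:
  assumes "0 \<le> d" "\<And>s. s > d \<Longrightarrow> hausdorff_measure s A = 0"
  shows "hausdorff_dim A \<le> ereal d"
proof (rule ereal_le_epsilon2)
  fix e :: real assume "e > 0"
  then show "hausdorff_dim A \<le> ereal d + ereal e"
    unfolding hausdorff_dim_def using assms by (intro Inf_lower) auto
qed

lemma hausdorff_dim_geI:
  assumes "\<And>s. 0 \<le> s \<Longrightarrow> s < d \<Longrightarrow> hausdorff_measure s A \<noteq> 0"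
  shows "ereal d \<le> hausdorff_dim A"
  unfolding hausdorff_dim_def using assms by (intro Inf_greatest) (auto simp: not_less[symmetric])

lemma hausdorff_dim_nonneg: "0 \<le> hausdorff_dim A"
  unfolding hausdorff_dim_def by (intro Inf_greatest) auto

subsection \<open>Complete quotients and continued fractions\<close>

declare complete_quotient.simps(2) [simp del]

lemma complete_quotient_step:
  assumes "x \<notin> \<rat>"
  shows "complete_quotient x n = partial_quotient x n + 1 / complete_quotient x (Suc n)"
proof -
  have "frac (complete_quotient x n) \<noteq> 0"
    using complete_quotient_irrational[OF assms, of n] Ints_subset_Rats by auto
  then show ?thesis by (simp add: partial_quotient_def frac_def complete_quotient.simps(2))
qed

lemma partial_quotient_bounds:
  "of_int (partial_quotient x n) \<le> complete_quotient x n"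
  "complete_quotient x n < of_int (partial_quotient x n) + 1"
  by (auto simp: partial_quotient_def)

lemma complete_quotient_ge_1:
  assumes "x \<notin> \<rat>" "n \<ge> 1"
  shows "complete_quotient x n \<ge> 1"
  using partial_quotient_pos[OF assms] partial_quotient_bounds(1)[of x n]
  by (meson of_int_1_le_iff order_trans)

text \<open>Equal digits cancel in \<open>complete_quotient_step\<close>, leaving
  \<open>X_k - Y_k = 1/X_(k+1) - 1/Y_(k+1)\<close>, so each common digit contributes one factor
  \<open>1/(X_(k+1) Y_(k+1))\<close>. Index 0 in \<open>eq\<close> makes the integer parts
  agree.\<close>

lemma dist_complete_quotient:
  assumes irr: "x \<notin> \<rat>" "y \<notin> \<rat>"
    and eq: "\<And>k. k \<le> n \<Longrightarrow> partial_quotient x k = partial_quotient y k"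
  shows "\<bar>x - y\<bar> = \<bar>complete_quotient x (Suc n) - complete_quotient y (Suc n)\<bar>
      / (\<Prod>k=1..Suc n. complete_quotient x k * complete_quotient y k)"
  using eq
proof (induction n)
  case 0
  have "x - y = 1 / complete_quotient x 1 - 1 / complete_quotient y 1"
    using complete_quotient_step[OF irr(1), of 0] complete_quotient_step[OF irr(2), of 0] 0[of 0] by simp
  moreover have "complete_quotient x 1 \<ge> 1" "complete_quotient y 1 \<ge> 1"
    using complete_quotient_ge_1[of x 1] complete_quotient_ge_1[of y 1] irr by simp_all
  ultimately have "x - y = (complete_quotient y 1 - complete_quotient x 1)
      / (complete_quotient x 1 * complete_quotient y 1)"
    by (simp add: divide_simps)
  then have "\<bar>x - y\<bar> = \<bar>complete_quotient y 1 - complete_quotient x 1\<bar>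
      / \<bar>complete_quotient x 1 * complete_quotient y 1\<bar>"
    by (simp only: abs_divide)
  also have "\<bar>complete_quotient x 1 * complete_quotient y 1\<bar> = complete_quotient x 1 * complete_quotient y 1"
    using \<open>complete_quotient x 1 \<ge> 1\<close> \<open>complete_quotient y 1 \<ge> 1\<close> by (intro abs_of_nonneg) simp
  finally show ?case by (simp add: abs_minus_commute)
next
  case (Suc n)
  let ?X = "complete_quotient x" and ?Y = "complete_quotient y"
  have ge: "?X (Suc (Suc n)) \<ge> 1" "?Y (Suc (Suc n)) \<ge> 1"
    using complete_quotient_ge_1[of x "Suc (Suc n)"] complete_quotient_ge_1[of y "Suc (Suc n)"] irr by simp_all
  have "?X (Suc n) - ?Y (Suc n) = 1 / ?X (Suc (Suc n)) - 1 / ?Y (Suc (Suc n))"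
    using complete_quotient_step[OF irr(1), of "Suc n"] complete_quotient_step[OF irr(2), of "Suc n"]
      Suc.prems[of "Suc n"] by simp
  also have "\<dots> = (?Y (Suc (Suc n)) - ?X (Suc (Suc n))) / (?X (Suc (Suc n)) * ?Y (Suc (Suc n)))"
    using ge by (simp add: divide_simps)
  finally have step: "\<bar>?X (Suc n) - ?Y (Suc n)\<bar>
      = \<bar>?X (Suc (Suc n)) - ?Y (Suc (Suc n))\<bar> / (?X (Suc (Suc n)) * ?Y (Suc (Suc n)))"
    using ge by (simp add: abs_minus_commute abs_mult)
  have "\<bar>x - y\<bar> = \<bar>?X (Suc n) - ?Y (Suc n)\<bar> / (\<Prod>k=1..Suc n. ?X k * ?Y k)"
    using Suc by simp
  also have "\<dots> = \<bar>?X (Suc (Suc n)) - ?Y (Suc (Suc n))\<bar> / (\<Prod>k=1..Suc (Suc n). ?X k * ?Y k)"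
    unfolding step by (simp add: mult.commute)
  finally show ?case .
qed

section \<open>Existence of irrationals with prescribed partial quotients\<close>

text \<open>\<open>t n\<close> is the value of \<open>[a n, a (n+1), ...]\<close>. The first tail
  lies in a nested intersection of compact sets; the later ones follow by solving the recursion for
  \<open>t (Suc n)\<close>.\<close>

lemma continued_fraction_tails_exist:
  fixes a :: "nat \<Rightarrow> nat"
  assumes pos: "\<And>n. a n \<ge> 1"
  obtains t :: "nat \<Rightarrow> real" where "\<And>n. 0 < t n" "\<And>n. t n < 1" "\<And>n. t n = 1 / (a n + t (Suc n))"
proof -
  define f where "f n t = 1 / (a n + t)" for n and t :: real
  \<comment> \<open>\<open>K j n\<close> is the image of \<open>{0..1}\<close> under
    \<open>f n o ... o f (n + j - 1)\<close>: the values still possible for the tail at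
    \<open>n\<close> once \<open>j\<close> digits are known.\<close>
  define K where "K = rec_nat (\<lambda>n. {0..1}) (\<lambda>j Kj n. f n ` Kj (Suc n))"
  have K0: "K 0 n = {0..1}" and KS: "K (Suc j) n = f n ` K j (Suc n)" for j n
    by (simp_all add: K_def)
  have f01: "f n t \<in> {0..1}" if "t \<in> {0..1}" for n t
    using that pos[of n] by (auto simp: f_def divide_simps)
  have sub: "K j n \<subseteq> {0..1}" for j n
    by (induction j arbitrary: n) (simp add: K0, use f01 in \<open>fastforce simp: KS\<close>)
  have "compact (K j n) \<and> K j n \<noteq> {} \<and> K (Suc j) n \<subseteq> K j n" for j n
  proof (induction j arbitrary: n)
    case 0
    show ?case using f01 by (auto simp: K0 KS)
  next
    case (Suc j)
    have "continuous_on (K j (Suc n)) (f n)"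
      unfolding f_def using sub[of j "Suc n"] pos[of n]
      by (intro continuous_intros) (smt (verit) atLeastAtMost_iff of_nat_1 of_nat_le_iff subsetD)
    then show ?case
      using Suc[of "Suc n"] by (auto simp: KS intro: compact_continuous_image)
  qed
  then have cpt: "compact (K j n)" and ne: "K j n \<noteq> {}" and dec: "K (Suc j) n \<subseteq> K j n" for j n
    by auto
  have "K j 0 \<subseteq> K i 0" if "i \<le> j" for i j
    using lift_Suc_antimono_le[of "\<lambda>j. K j 0", OF dec that] .
  then have "\<Inter>(range (\<lambda>j. K j 0)) \<noteq> {}"
    using cpt ne by (intro compact_nest)
  then obtain t0 where t0: "\<And>j. t0 \<in> K j 0" by auto
  define t where "t = rec_nat t0 (\<lambda>n tn. 1 / tn - a n)"
  have t_simps: "t 0 = t0" "t (Suc n) = 1 / t n - a n" for n by (simp_all add: t_def)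
  \<comment> \<open>The recursion for \<open>t\<close> inverts \<open>f n\<close>, so membership at
    depth \<open>Suc j\<close> for \<open>n\<close> becomes membership at depth \<open>j\<close> for
    \<open>Suc n\<close>.\<close>
  have inK: "t n \<in> K j n" for n j
  proof (induction n arbitrary: j)
    case (Suc n)
    obtain u where u: "u \<in> K j (Suc n)" "t n = f n u" using Suc[of "Suc j"] by (auto simp: KS)
    then show ?case by (simp add: t_simps f_def)
  qed (use t0 t_simps in auto)
  have t01: "t n \<ge> 0" "t n \<le> 1" for n using inK[of n 0] by (auto simp: K0)
  have rec: "t n = 1 / (a n + t (Suc n))" for n
  proof -
    obtain u where "u \<in> K 0 (Suc n)" "t n = f n u" using inK[of n "Suc 0"] by (auto simp: KS)
    then show ?thesis using pos[of n] by (simp add: t_simps f_def)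
  qed
  have gt: "t n > 0" for n
    using rec[of n] t01(1)[of "Suc n"] pos[of n]
    by (metis add_nonneg_pos add.commute of_nat_0_less_iff less_le_trans zero_less_one zero_less_divide_1_iff)
  have "t n < 1" for n
  proof -
    have "1 < a n + t (Suc n)" using gt[of "Suc n"] pos[of n] by linarith
    then have "1 / (a n + t (Suc n)) < 1" by simp
    then show ?thesis by (simp flip: rec[of n])
  qed
  with gt rec that show thesis by blast
qed

text \<open>Infinite descent as in Euclid's algorithm: \<open>t n = p / q\<close> makes
  \<open>t (Suc n)\<close> a fraction with the smaller denominator \<open>p\<close>.\<close>

lemma irrational_of_infinite_expansion:
  fixes a :: "nat \<Rightarrow> nat" and t :: "nat \<Rightarrow> real"
  assumes t: "\<And>n. 0 < t n" "\<And>n. t n < 1" "\<And>n. t n = 1 / (a n + t (Suc n))"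
  shows "t n \<notin> \<rat>"
proof
  assume "t n \<in> \<rat>"
  have no: "t n \<noteq> real p / real q" if "q > 0" for n p q :: nat
    using that
  proof (induction q arbitrary: n p rule: less_induct)
    case (less q)
    show ?case
    proof
      assume eq: "t n = real p / real q"
      have p: "p > 0" "p < q" using t(1,2)[of n] less.prems by (auto simp: eq field_simps zero_less_divide_iff)
      have "a n + t (Suc n) = real q / real p"
        using t(3)[of n] t(1)[of "Suc n"] eq p by (simp add: field_simps)
      then have e: "t (Suc n) = (real q - a n * p) / p" using p by (simp add: field_simps)
      then have "real q - a n * p > 0" using t(1)[of "Suc n"] p by (simp add: zero_less_divide_iff)
      then have "real (a n * p) < real q" by simp
      then have "a n * p < q" by (simp only: of_nat_less_iff)
      then have "t (Suc n) = real (q - a n * p) / real p" using e by (simp add: of_nat_diff)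
      with less.IH[OF p(2,1)] show False by blast
    qed
  qed
  obtain p q :: nat where "q \<noteq> 0" "\<bar>t n\<bar> = real p / real q"
    using \<open>t n \<in> \<rat>\<close> by (rule Rats_abs_nat_div_natE)
  with no t(1)[of n] show False by simp
qed

text \<open>The point is \<open>t 0\<close>. The digits are shifted by one because
  \<open>partial_quotient x 0\<close> is the integer part.\<close>

lemma continued_fraction_exists:
  fixes a :: "nat \<Rightarrow> nat"
  assumes "\<And>n. a n \<ge> 1"
  obtains x where "0 \<le> x" "x < 1" "x \<notin> \<rat>" "\<And>n. partial_quotient x (Suc n) = int (a n)"
proof -
  obtain t :: "nat \<Rightarrow> real" where t: "\<And>n. 0 < t n" "\<And>n. t n < 1" "\<And>n. t n = 1 / (a n + t (Suc n))"
    using continued_fraction_tails_exist[of a] assms by blast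
  have frac: "frac (real k + t n) = t n" for n k
    using t(1,2)[of n] by (simp add: frac_unique_iff)
  have inv: "1 / t n = a n + t (Suc n)" for n
    using t(3)[of n] by (metis div_by_1 divide_divide_eq_right mult_1)
  have cq: "complete_quotient (t 0) (Suc n) = a n + t (Suc n)" for n
  proof (induction n)
    case 0
    show ?case using frac[of 0 0] inv[of 0] by (simp add: complete_quotient.simps(2))
  next
    case (Suc n)
    show ?case
      by (subst complete_quotient.simps(2), subst Suc, subst frac) (rule inv)
  qed
  have "partial_quotient (t 0) (Suc n) = int (a n)" for n
    unfolding partial_quotient_def cq using t(1,2)[of "Suc n"] by (simp add: floor_eq_iff)
  moreover have "t 0 \<notin> \<rat>"
    using irrational_of_infinite_expansion[of t a 0, OF t(1) t(2) t(3)] .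
  ultimately show thesis
    using that[of "t 0"] t(1,2)[of 0] by simp
qed

subsection \<open>Covering by cylinders\<close>

text \<open>In the distance identity \<open>X_k Y_k\<close> is at least the square of the common
  digit for \<open>k <= n\<close>. The remaining factor is \<open>|1/Y - 1/X|\<close> at index
  \<open>n + 1\<close>, and both reciprocals lie between 0 and \<open>1/T\<close>.\<close>

lemma cylinder_dist_le:
  fixes T :: real
  assumes irr: "x \<notin> \<rat>" "y \<notin> \<rat>"
    and eq: "\<And>k. k \<le> n \<Longrightarrow> partial_quotient x k = partial_quotient y k"
    and T: "T > 0" "T \<le> partial_quotient x (Suc n)" "T \<le> partial_quotient y (Suc n)"
  shows "\<bar>x - y\<bar> \<le> 1 / ((\<Prod>k=1..n. real_of_int (partial_quotient x k))\<^sup>2 * T)"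
proof -
  let ?X = "complete_quotient x" and ?Y = "complete_quotient y"
  let ?P = "\<Prod>k=1..n. real_of_int (partial_quotient x k)"
  have TX: "T \<le> ?X (Suc n)" "T \<le> ?Y (Suc n)"
    using T partial_quotient_bounds(1) order_trans by blast+
  have "?P > 0"
    using partial_quotient_pos[OF irr(1)] by (intro prod_pos) (auto intro: less_le_trans[of _ 1])
  have "(\<Prod>k=1..n. real_of_int (partial_quotient x k) * real_of_int (partial_quotient x k))
      \<le> (\<Prod>k=1..n. ?X k * ?Y k)"
  proof (intro prod_mono conjI mult_mono)
    fix k assume k: "k \<in> {1..n}"
    then have "1 \<le> partial_quotient x k" using partial_quotient_pos[OF irr(1)] by simp
    then show nn: "0 \<le> real_of_int (partial_quotient x k)" by simp
    then show "0 \<le> real_of_int (partial_quotient x k) * real_of_int (partial_quotient x k)" by simp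
    show X: "real_of_int (partial_quotient x k) \<le> ?X k" using partial_quotient_bounds by simp
    show "real_of_int (partial_quotient x k) \<le> ?Y k"
      using partial_quotient_bounds[of y k] eq[of k] k by simp
    show "0 \<le> ?X k" using nn X by simp
  qed
  then have P: "?P\<^sup>2 \<le> (\<Prod>k=1..n. ?X k * ?Y k)"
    by (simp add: power2_eq_square prod.distrib)
  have "\<bar>?X (Suc n) - ?Y (Suc n)\<bar> / (?X (Suc n) * ?Y (Suc n)) = \<bar>1 / ?Y (Suc n) - 1 / ?X (Suc n)\<bar>"
    using TX T(1) by (simp add: field_simps abs_divide abs_mult)
  also have "\<dots> \<le> 1 / T"
  proof -
    have "0 \<le> 1 / ?X (Suc n)" "1 / ?X (Suc n) \<le> 1 / T" "0 \<le> 1 / ?Y (Suc n)" "1 / ?Y (Suc n) \<le> 1 / T"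
      using TX T(1) by (auto intro!: divide_left_mono mult_pos_pos)
    then show ?thesis by linarith
  qed
  finally have last: "\<bar>?X (Suc n) - ?Y (Suc n)\<bar> / (?X (Suc n) * ?Y (Suc n)) \<le> 1 / T" .
  have "\<bar>x - y\<bar> = \<bar>?X (Suc n) - ?Y (Suc n)\<bar> / (?X (Suc n) * ?Y (Suc n)) / (\<Prod>k=1..n. ?X k * ?Y k)"
    using dist_complete_quotient[OF irr eq, of n] by (simp add: mult.commute)
  also have "\<dots> \<le> (1 / T) / ?P\<^sup>2"
    using T(1) zero_less_power[OF \<open>?P > 0\<close>, of 2] by (intro frac_le[OF _ last _ P]) simp_all
  finally show ?thesis by (simp add: mult.commute)
qed

section \<open>Sums over words of digits\<close>

text \<open>Appending at the end ties the entry at position \<open>i\<close> to \<open>V i\<close>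
  and matches \<open>cf_prefix_Suc\<close>.\<close>

primrec words :: "(nat \<Rightarrow> nat set) \<Rightarrow> nat \<Rightarrow> nat list set" where
  "words V 0 = {[]}"
| "words V (Suc n) = (\<lambda>(l, a). l @ [a]) ` (words V n \<times> V n)"

text \<open>The weight is multiplicative and the words form a product set, so Tonelli's theorem
  factors the sum.\<close>

lemma nn_integral_words_prod_list:
  "(\<integral>\<^sup>+l. ennreal (real (prod_list l) powr u) \<partial>count_space (words V n))
    = (\<Prod>i<n. \<integral>\<^sup>+a. ennreal (real a powr u) \<partial>count_space (V i))"
proof (induction n)
  case 0
  show ?case by (simp add: nn_integral_count_space_finite)
next
  case (Suc n)
  let ?w = "\<lambda>l. ennreal (real (prod_list l) powr u)" and ?v = "\<lambda>a. ennreal (real a powr u)"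
  have "(\<integral>\<^sup>+l. ?w l \<partial>count_space (words V (Suc n)))
      = (\<integral>\<^sup>+p. ?w ((\<lambda>(l, a). l @ [a]) p) \<partial>count_space (words V n \<times> V n))"
    by (rule nn_integral_bij_count_space[symmetric]) (auto simp: bij_betw_def inj_on_def)
  also have "\<dots> = (\<integral>\<^sup>+p. ?w (fst p) * ?v (snd p) * indicator (words V n \<times> V n) p \<partial>count_space UNIV)"
    by (subst nn_integral_count_space_indicator)
       (auto intro!: nn_integral_cong simp: powr_mult ennreal_mult split: prod.splits)
  also have "\<dots> = (\<integral>\<^sup>+l. \<integral>\<^sup>+a. (?w l * indicator (words V n) l) * (?v a * indicator (V n) a)
      \<partial>count_space UNIV \<partial>count_space UNIV)"
    by (subst nn_integral_fst_count_space[symmetric])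
       (auto intro!: nn_integral_cong simp: indicator_def)
  also have "\<dots> = (\<integral>\<^sup>+l. ?w l * indicator (words V n) l \<partial>count_space UNIV)
      * (\<integral>\<^sup>+a. ?v a * indicator (V n) a \<partial>count_space UNIV)"
    by (simp add: nn_integral_cmult nn_integral_multc)
  also have "\<dots> = (\<integral>\<^sup>+l. ?w l \<partial>count_space (words V n)) * (\<integral>\<^sup>+a. ?v a \<partial>count_space (V n))"
    by (simp add: nn_integral_count_space_indicator)
  finally show ?case by (simp add: Suc mult.commute)
qed

lemma nn_integral_powr_atLeast:
  assumes "t > 1"
  shows "(\<integral>\<^sup>+a. ennreal (real a powr - t) \<partial>count_space {M..}) = ennreal (\<Sum>i. real (i + M) powr - t)"
proof -
  have "summable (\<lambda>i. real i powr - t)" using assms by (simp add: summable_real_powr_iff)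
  then have "summable (\<lambda>i. real (i + M) powr - t)" by (rule summable_ignore_initial_segment)
  moreover have "(\<integral>\<^sup>+a. ennreal (real a powr - t) \<partial>count_space {M..})
      = (\<integral>\<^sup>+i. ennreal (real (i + M) powr - t) \<partial>count_space UNIV)"
    by (rule nn_integral_bij_count_space[symmetric])
       (auto intro!: bij_betwI[where g = "\<lambda>a. a - M"])
  ultimately show ?thesis
    by (simp add: nn_integral_count_space_nat suminf_ennreal2)
qed

text \<open>\<open>M\<close> is chosen so that the tail of the zeta series from \<open>M\<close> on
  is at most 1/4; each restricted position then contributes a factor of at most 1/4. The
  \<open>K\<close> free positions only affect the constant \<open>D\<close>, so \<open>M\<close>
  does not depend on \<open>K\<close>.\<close>

lemma nn_integral_words_geometric:
  assumes "t > 1"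
  obtains M :: nat where "M \<ge> 1" "\<And>K. \<exists>D>0. \<forall>n.
    (\<integral>\<^sup>+l. ennreal (real (prod_list l) powr - t) \<partial>count_space (words (\<lambda>i. if i < K then {1..} else {M..}) n))
      \<le> ennreal (D * (1/4)^n)"
proof -
  define \<zeta> where "\<zeta> M = (\<Sum>i. real (i + M) powr - t)" for M
  have sum: "summable (\<lambda>i. real i powr - t)" using assms by (simp add: summable_real_powr_iff)
  obtain M0 where "\<And>n. n \<ge> M0 \<Longrightarrow> norm (\<zeta> n) < 1/4"
    unfolding \<zeta>_def using suminf_exist_split[OF _ sum, of "1/4"] by auto
  then have M: "\<zeta> (max M0 1) \<le> 1/4"
    by (metis abs_le_D1 less_imp_le max.cobounded1 real_norm_def)
  define M where "M = max M0 1"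
  \<comment> \<open>A free position contributes at most \<open>W / 4\<close>, and
    \<open>W >= 1\<close> lets the number of free positions below \<open>n\<close> be replaced by
    \<open>K\<close>.\<close>
  define W where "W = max 1 (4 * \<zeta> 1)"
  have "\<exists>D>0. \<forall>n. (\<integral>\<^sup>+l. ennreal (real (prod_list l) powr - t)
      \<partial>count_space (words (\<lambda>i. if i < K then {1..} else {M..}) n)) \<le> ennreal (D * (1/4)^n)" for K
  proof (intro exI[of _ "W ^ K"] conjI allI)
    show "W ^ K > 0" by (simp add: W_def)
    fix n
    have "(\<integral>\<^sup>+l. ennreal (real (prod_list l) powr - t)
      \<partial>count_space (words (\<lambda>i. if i < K then {1..} else {M..}) n))
      = (\<Prod>i<n. if i < K then ennreal (\<zeta> 1) else ennreal (\<zeta> M))"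
      unfolding nn_integral_words_prod_list
      using nn_integral_powr_atLeast[OF assms, of 1] nn_integral_powr_atLeast[OF assms, of M]
      by (intro prod.cong) (auto simp: \<zeta>_def)
    also have "\<dots> \<le> (\<Prod>i<n. ennreal ((if i < K then W else 1) * (1/4)))"
      using M by (intro prod_mono_ennreal) (auto intro!: ennreal_leI simp: W_def M_def)
    also have "\<dots> = ennreal (\<Prod>i<n. (if i < K then W else 1) * (1/4))"
      by (intro prod_ennreal) (auto simp: W_def)
    also have "(\<Prod>i<n. (if i < K then W else 1) * (1/4)) = (\<Prod>i<n. if i < K then W else 1) * (1/4)^n"
      by (simp only: prod.distrib prod_constant card_lessThan)
    also have "(\<Prod>i<n. if i < K then W else 1) = W ^ card {i. i < n \<and> i < K}"
      by (simp add: prod.If_cases Int_def)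
    also have "W ^ card {i. i < n \<and> i < K} * (1/4)^n \<le> W ^ K * (1/4)^n"
    proof (intro mult_right_mono power_increasing)
      have "card {i. i < n \<and> i < K} \<le> card {..<K}" by (intro card_mono) auto
      then show "card {i. i < n \<and> i < K} \<le> K" by simp
    qed (auto simp: W_def)
    finally show "(\<integral>\<^sup>+l. ennreal (real (prod_list l) powr - t)
      \<partial>count_space (words (\<lambda>i. if i < K then {1..} else {M..}) n)) \<le> ennreal (W ^ K * (1/4)^n)"
      by (simp add: ennreal_leI)
  qed
  then show thesis using that[of M] by (simp add: M_def)
qed

section \<open>Covering points that lie in infinitely many truncated cylinders\<close>

definition cf_prefix :: "real \<Rightarrow> nat \<Rightarrow> nat list" where
  "cf_prefix x n = map (\<lambda>k. nat (partial_quotient x (Suc k))) [0..<n]"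

lemma cf_prefix_Suc: "cf_prefix x (Suc n) = cf_prefix x n @ [nat (partial_quotient x (Suc n))]"
  by (simp add: cf_prefix_def)

lemma prod_list_cf_prefix:
  assumes "x \<notin> \<rat>"
  shows "real (prod_list (cf_prefix x n)) = (\<Prod>k=1..n. real_of_int (partial_quotient x k))"
proof (induction n)
  case (Suc n)
  then show ?case
    using partial_quotient_pos[OF assms, of "Suc n"] by (simp add: cf_prefix_Suc)
qed (simp add: cf_prefix_def)

lemma cf_prefix_in_words:
  assumes "\<And>k. k < n \<Longrightarrow> nat (partial_quotient x (Suc k)) \<in> V k"
  shows "cf_prefix x n \<in> words V n"
  using assms by (induction n) (auto simp: cf_prefix_Suc cf_prefix_def[of x 0])

lemma cf_prefix_eqD:
  assumes "cf_prefix x n = cf_prefix y n" "1 \<le> k" "k \<le> n" "x \<notin> \<rat>" "y \<notin> \<rat>"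
  shows "partial_quotient x k = partial_quotient y k"
proof -
  have "cf_prefix x n ! (k - 1) = cf_prefix y n ! (k - 1)" using assms(1) by simp
  then have "nat (partial_quotient x k) = nat (partial_quotient y k)" using assms(2,3) by (simp add: cf_prefix_def)
  then show ?thesis
    using partial_quotient_pos[OF assms(4,2)] partial_quotient_pos[OF assms(5,2)] by simp
qed

text \<open>\<open>J\<close> is the part of a cylinder on which the next digit is large. With
  \<open>Q\<close> the product of the word, \<open>cylinder_dist_le\<close> for
  \<open>T = Q^(c-1)\<close> bounds its diameter by
  \<open>Q^(-2) Q^(-(c-1)) = Q^(-(c+1))\<close>.\<close>

lemma diam_pow_cylinder:
  fixes l :: "nat list" and n :: nat
  assumes c: "c \<ge> 1" "s > 0"
  defines "J \<equiv> {x. 0 \<le> x \<and> x < 1 \<and> x \<notin> \<rat> \<and> cf_prefix x n = l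
      \<and> real (prod_list l) powr (c - 1) \<le> partial_quotient x (Suc n)}"
  shows "bounded J" "diam_pow s J \<le> ennreal (real (prod_list l) powr - ((c + 1) * s))"
proof -
  show bdd: "bounded J"
    by (rule bounded_subset[of "{0..1}"]) (auto simp: J_def)
  let ?Q = "real (prod_list l)"
  show "diam_pow s J \<le> ennreal (?Q powr - ((c + 1) * s))"
  proof (cases "J = {}")
    case False
    then obtain x where x: "x \<in> J" by blast
    have Q: "?Q > 0"
      using prod_list_cf_prefix[of x n] partial_quotient_pos[of x] x
      by (auto simp: J_def intro!: prod_pos intro: less_le_trans[of _ 1])
    have "\<bar>y - z\<bar> \<le> ?Q powr - (c + 1)" if yz: "y \<in> J" "z \<in> J" for y z
    proof -
      have "partial_quotient y k = partial_quotient z k" if "k \<le> n" for k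
      proof (cases k)
        \<comment> \<open>Index 0 is the integer part, which \<open>cf_prefix\<close> does not
          record; it vanishes on \<open>[0,1)\<close>.\<close>
        case 0
        have "\<lfloor>y\<rfloor> = 0" "\<lfloor>z\<rfloor> = 0" using yz by (auto simp: J_def floor_eq_iff)
        then show ?thesis using 0 by (simp add: partial_quotient_def)
      qed (use yz that cf_prefix_eqD[of y n z k] in \<open>auto simp: J_def\<close>)
      then have "\<bar>y - z\<bar> \<le> 1 / ((\<Prod>k=1..n. real_of_int (partial_quotient y k))\<^sup>2 * ?Q powr (c - 1))"
        using yz Q by (intro cylinder_dist_le) (auto simp: J_def)
      also have "(\<Prod>k=1..n. real_of_int (partial_quotient y k)) = ?Q"
        using yz prod_list_cf_prefix[of y n] by (auto simp: J_def)
      also have "?Q\<^sup>2 * ?Q powr (c - 1) = ?Q powr (2 + (c - 1))"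
        using Q by (subst powr_add) simp
      also have "1 / \<dots> = ?Q powr - (c + 1)"
        using powr_minus_divide[of ?Q "c + 1"] by (simp add: add.commute)
      finally show ?thesis .
    qed
    then have "diameter J \<le> ?Q powr - (c + 1)"
      using False by (intro diameter_le) auto
    then have "diameter J powr s \<le> (?Q powr - (c + 1)) powr s"
      using c bdd by (intro powr_mono2) (auto intro: diameter_ge_0)
    then show ?thesis
      unfolding powr_powr minus_mult_left[symmetric] using False c by (simp add: diam_pow_def ennreal_leI)
  qed (simp add: diam_pow_def)
qed

text \<open>Every point of \<open>A\<close> lies in truncated cylinders of arbitrarily high level,
  so those of level at least \<open>N\<close> cover \<open>A\<close>. Their cost is a sum of
  \<open>Q^(-t)\<close> over words with \<open>t = (c + 1) s > 1\<close>, which is geometrically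
  small once digits below \<open>M\<close> are excluded.\<close>

theorem hausdorff_measure_limsup_cylinders:
  assumes c: "c \<ge> 1" "s > 1 / (c + 1)"
    and A: "\<And>x. x \<in> A \<Longrightarrow> 0 \<le> x \<and> x < 1 \<and> x \<notin> \<rat>"
    and lim: "\<And>x. x \<in> A \<Longrightarrow> filterlim (partial_quotient x) at_top sequentially"
    and freq: "\<And>x. x \<in> A \<Longrightarrow> \<exists>\<^sub>F n in sequentially.
      (\<Prod>k=1..n. real_of_int (partial_quotient x k)) powr (c - 1) \<le> partial_quotient x (Suc n)"
  shows "hausdorff_measure s A = 0"
proof -
  define t where "t = (c + 1) * s"
  have "t > 1" using c by (simp add: t_def field_simps)
  have "s > 0" using c by (smt (verit) divide_nonneg_pos)
  obtain M :: nat where "M \<ge> 1" and M: "\<And>K. \<exists>D>0. \<forall>n. (\<integral>\<^sup>+l. ennreal (real (prod_list l) powr - t)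
      \<partial>count_space (words (\<lambda>i. if i < K then {1..} else {M..}) n)) \<le> ennreal (D * (1/4)^n)"
    using nn_integral_words_geometric[OF \<open>t > 1\<close>] by blast
  \<comment> \<open>As \<open>M\<close> is independent of \<open>K\<close>, these countably many
    pieces exhaust \<open>A\<close>; on each of them only the first \<open>K\<close> digits may be
    small.\<close>
  define AK where "AK K = {x \<in> A. \<forall>k\<ge>K. int M \<le> partial_quotient x (Suc k)}" for K
  have "A \<subseteq> (\<Union>K. AK K)"
  proof
    fix x assume x: "x \<in> A"
    then have "eventually (\<lambda>n. int M \<le> partial_quotient x n) sequentially"
      using lim[OF x] by (simp add: filterlim_at_top)
    then obtain K where "\<And>n. n \<ge> K \<Longrightarrow> int M \<le> partial_quotient x n"
      by (auto simp: eventually_sequentially)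
    then have "x \<in> AK K" using x by (simp add: AK_def)
    then show "x \<in> (\<Union>K. AK K)" by blast
  qed
  moreover have "hausdorff_measure s (AK K) = 0" for K
  proof (rule hausdorff_measure_eq_0I[OF \<open>s > 0\<close>])
    fix e :: real assume "e > 0"
    define V where "V i = (if i < K then {1..} else {M..})" for i
    define w where "w l = ennreal (real (prod_list l) powr - t)" for l
    obtain D where "D > 0" and D: "\<And>n. (\<integral>\<^sup>+l. w l \<partial>count_space (words V n)) \<le> ennreal (D * (1/4)^n)"
      using M[of K] by (auto simp: V_def[abs_def] w_def)
    obtain N where "(1/2)^N < e / (2 * D)"
      using real_arch_pow_inv[of "e / (2 * D)" "1/2"] \<open>e > 0\<close> \<open>D > 0\<close> by auto
    then have N: "2 * D * (1/2)^N \<le> e" using \<open>D > 0\<close> by (simp add: field_simps)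
    define J where "J n l = {x. 0 \<le> x \<and> x < 1 \<and> x \<notin> \<rat> \<and> cf_prefix x n = l
      \<and> real (prod_list l) powr (c - 1) \<le> partial_quotient x (Suc n)}" for n and l :: "nat list"
    define U where "U = (\<lambda>(n, l). if N \<le> n \<and> l \<in> words V n then J n l else {})"
    have "AK K \<subseteq> (\<Union>p. U p)"
    proof
      fix x assume x: "x \<in> AK K"
      then have xA: "x \<in> A" "x \<notin> \<rat>" using A by (auto simp: AK_def)
      obtain n where n: "N \<le> n"
        "(\<Prod>k=1..n. real_of_int (partial_quotient x k)) powr (c - 1) \<le> partial_quotient x (Suc n)"
        using freq[OF xA(1)] by (auto simp: frequently_sequentially)
      have "nat (partial_quotient x (Suc k)) \<in> V k" for k
        using x partial_quotient_pos[OF xA(2), of "Suc k"] by (auto simp: AK_def V_def le_nat_iff)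
      then have "cf_prefix x n \<in> words V n" by (intro cf_prefix_in_words)
      then have "x \<in> U (n, cf_prefix x n)"
        using n A[OF xA(1)] prod_list_cf_prefix[OF xA(2), of n] by (simp add: U_def J_def)
      then show "x \<in> (\<Union>p. U p)" by blast
    qed
    moreover have J: "bounded (J n l)" "diam_pow s (J n l) \<le> w l" for n l
      using diam_pow_cylinder[OF c(1) \<open>s > 0\<close>, of n l] by (simp_all add: J_def w_def t_def)
    then have "\<forall>p. bounded (U p)" by (auto simp: U_def)
    moreover have "(\<integral>\<^sup>+p. diam_pow s (U p) \<partial>count_space UNIV)
        = (\<integral>\<^sup>+n. \<integral>\<^sup>+l. diam_pow s (U (n, l)) \<partial>count_space UNIV \<partial>count_space UNIV)"
      using nn_integral_fst_count_space[of "\<lambda>p. diam_pow s (U p)"] by simp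
    moreover have "\<dots> \<le> (\<integral>\<^sup>+n. ennreal (D * (1/2)^N * (1/2)^n) \<partial>count_space UNIV)"
    proof (rule nn_integral_mono)
      fix n :: nat
      show "(\<integral>\<^sup>+l. diam_pow s (U (n, l)) \<partial>count_space UNIV) \<le> ennreal (D * (1/2)^N * (1/2)^n)"
      proof (cases "N \<le> n")
        case True
        have "(\<integral>\<^sup>+l. diam_pow s (U (n, l)) \<partial>count_space UNIV)
            \<le> (\<integral>\<^sup>+l. w l * indicator (words V n) l \<partial>count_space UNIV)"
          using J by (intro nn_integral_mono) (auto simp: U_def diam_pow_def[of s "{}"] indicator_def)
        also have "\<dots> = (\<integral>\<^sup>+l. w l \<partial>count_space (words V n))"
          by (simp add: nn_integral_count_space_indicator)
        also have "\<dots> \<le> ennreal (D * (1/4)^n)" by (rule D)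
        also have "\<dots> \<le> ennreal (D * (1/2)^N * (1/2)^n)"
        proof (rule ennreal_leI)
          \<comment> \<open>One factor \<open>(1/2)^n\<close> provides the smallness
            \<open>(1/2)^N\<close>, the other the convergence of the sum over
            \<open>n\<close>.\<close>
          have "(1/4::real)^n = (1/2)^n * (1/2)^n" by (simp flip: power_mult_distrib)
          also have "\<dots> \<le> (1/2)^N * (1/2)^n"
            using True by (intro mult_right_mono power_decreasing) auto
          finally show "D * (1/4)^n \<le> D * (1/2)^N * (1/2)^n"
            using \<open>D > 0\<close> by simp
        qed
        finally show ?thesis .
      qed (simp add: U_def diam_pow_def)
    qed
    moreover have "\<dots> = ennreal (D * (1/2)^N * 2)"
      unfolding nn_integral_count_space_nat
      using sums_mult[OF geometric_sums[of "1/2::real"], of "D * (1/2)^N"] \<open>D > 0\<close>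
      by (intro suminf_ennreal_eq) auto
    moreover have "\<dots> \<le> ennreal e" using N by (intro ennreal_leI) (simp add: mult_ac)
    ultimately show "\<exists>U :: nat \<times> nat list \<Rightarrow> real set. AK K \<subseteq> (\<Union>p. U p) \<and> (\<forall>p. bounded (U p)) \<and>
        (\<integral>\<^sup>+p. diam_pow s (U p) \<partial>count_space UNIV) \<le> ennreal e"
      by (metis order_trans)
  qed
  then have "hausdorff_measure s (\<Union>K. AK K) = 0" by (rule hausdorff_measure_UN_eq_0[OF \<open>s > 0\<close>])
  ultimately show ?thesis using hausdorff_measure_mono by (metis le_zero_eq)
qed

subsection \<open>Digits in prescribed windows\<close>

text \<open>A next digit of at least 2 gives \<open>X_(n+1) <= a + 1/2\<close>, with
  \<open>a\<close> the digit of \<open>x\<close>. A digit difference \<open>d >= 1\<close> thus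
  leaves a gap of at least \<open>d - 1/2 >= d/2\<close>. Digits being integers, those below
  \<open>r k\<close> have complete quotients at most \<open>r k\<close>.\<close>

lemma dist_ge_of_partial_quotients:
  assumes irr: "x \<notin> \<rat>" "y \<notin> \<rat>"
    and eq: "\<And>k. k \<le> n \<Longrightarrow> partial_quotient x k = partial_quotient y k"
    and lt: "partial_quotient x (Suc n) < partial_quotient y (Suc n)"
    and next2: "2 \<le> partial_quotient x (Suc (Suc n))"
    and less: "\<And>k. 1 \<le> k \<Longrightarrow> k \<le> Suc n \<Longrightarrow> partial_quotient x k < r k \<and> partial_quotient y k < r k"
  shows "(partial_quotient y (Suc n) - partial_quotient x (Suc n)) / (2 * (\<Prod>k=1..Suc n. real_of_int (r k))\<^sup>2)
    \<le> \<bar>x - y\<bar>"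
proof -
  let ?X = "complete_quotient x" and ?Y = "complete_quotient y"
  let ?d = "real_of_int (partial_quotient y (Suc n) - partial_quotient x (Suc n))"
  have bnd: "1 \<le> ?X k" "?X k \<le> r k" "1 \<le> ?Y k" "?Y k \<le> r k" if "1 \<le> k" "k \<le> Suc n" for k
    using complete_quotient_ge_1[OF irr(1) that(1)] complete_quotient_ge_1[OF irr(2) that(1)]
      partial_quotient_bounds(2)[of x k] partial_quotient_bounds(2)[of y k] less[OF that]
    by auto
  have "2 \<le> ?X (Suc (Suc n))" using next2 partial_quotient_bounds(1)[of x "Suc (Suc n)"] by linarith
  then have "1 / ?X (Suc (Suc n)) \<le> 1 / 2" by (intro divide_left_mono) auto
  then have "?X (Suc n) \<le> partial_quotient x (Suc n) + 1 / 2"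
    using complete_quotient_step[OF irr(1), of "Suc n"] by simp
  moreover have "?d \<ge> 1" using lt by linarith
  ultimately have num: "?d / 2 \<le> \<bar>?X (Suc n) - ?Y (Suc n)\<bar>"
    using partial_quotient_bounds(1)[of y "Suc n"] by simp
  have "(\<Prod>k=1..Suc n. ?X k * ?Y k) \<le> (\<Prod>k=1..Suc n. real_of_int (r k) * real_of_int (r k))"
  proof (intro prod_mono conjI mult_mono)
    fix k assume "k \<in> {1..Suc n}"
    then have k: "1 \<le> k" "k \<le> Suc n" by auto
    show "?X k \<le> real_of_int (r k)" "?Y k \<le> real_of_int (r k)" "0 \<le> ?Y k"
      "0 \<le> real_of_int (r k)" "0 \<le> ?X k * ?Y k"
      using bnd[OF k] by auto
  qed
  then have den: "(\<Prod>k=1..Suc n. ?X k * ?Y k) \<le> (\<Prod>k=1..Suc n. real_of_int (r k))\<^sup>2"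
    by (simp only: power2_eq_square prod.distrib)
  have pos: "(\<Prod>k=1..Suc n. ?X k * ?Y k) > 0"
  proof (intro prod_pos mult_pos_pos)
    fix k assume "k \<in> {1..Suc n}"
    then show "0 < ?X k" "0 < ?Y k" using bnd[of k] by auto
  qed
  have "?d / (2 * (\<Prod>k=1..Suc n. real_of_int (r k))\<^sup>2) = (?d / 2) / (\<Prod>k=1..Suc n. real_of_int (r k))\<^sup>2"
    by simp
  also have "\<dots> \<le> \<bar>?X (Suc n) - ?Y (Suc n)\<bar> / (\<Prod>k=1..Suc n. ?X k * ?Y k)"
    using num den pos by (intro frac_le) auto
  also have "\<dots> = \<bar>x - y\<bar>"
    using dist_complete_quotient[OF irr eq, of n] by simp
  finally show ?thesis .
qed

section \<open>Mass distribution on window sets\<close>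

text \<open>In terms of \<open>n = i + 1\<close> the window of the \<open>n\<close>-th digit runs
  from \<open>n m\<close> to \<open>(n + 1) m\<close>. It holds exactly \<open>m i\<close> digits,
  and if \<open>m\<close> is non-decreasing it ends no later than the next window begins.\<close>

definition window_set :: "(nat \<Rightarrow> nat) \<Rightarrow> real set" where
  "window_set m = {x. 0 \<le> x \<and> x < 1 \<and> x \<notin> \<rat> \<and>
     (\<forall>i. int ((i + 1) * m i) \<le> partial_quotient x (Suc i) \<and> partial_quotient x (Suc i) < int ((i + 2) * m i))}"

lemma window_set_dist_ge:
  assumes x: "x \<in> window_set m" and y: "y \<in> window_set m" and m: "\<And>i. m i \<ge> 1"
    and eq: "\<And>i. i < n \<Longrightarrow> partial_quotient x (Suc i) = partial_quotient y (Suc i)"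
    and lt: "partial_quotient x (Suc n) < partial_quotient y (Suc n)"
  shows "(partial_quotient y (Suc n) - partial_quotient x (Suc n)) / (2 * (\<Prod>i\<le>n. real ((i + 2) * m i))\<^sup>2)
    \<le> \<bar>x - y\<bar>"
proof -
  have x': "0 \<le> x" "x < 1" "x \<notin> \<rat>" "int ((i + 1) * m i) \<le> partial_quotient x (Suc i)"
      "partial_quotient x (Suc i) < int ((i + 2) * m i)" for i
    using x by (auto simp: window_set_def)
  have y': "0 \<le> y" "y < 1" "y \<notin> \<rat>" "partial_quotient y (Suc i) < int ((i + 2) * m i)" for i
    using y by (auto simp: window_set_def)
  have eq': "partial_quotient x k = partial_quotient y k" if "k \<le> n" for k
  proof (cases k)
    case 0
    have "\<lfloor>x\<rfloor> = 0" "\<lfloor>y\<rfloor> = 0" using x' y' by (auto simp: floor_eq_iff)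
    then show ?thesis using 0 by (simp add: partial_quotient_def)
  qed (use eq that in auto)
  \<comment> \<open>The factor \<open>n + 2\<close> in the lower end of the following window
    supplies the digit bound 2 for \<open>dist_ge_of_partial_quotients\<close>.\<close>
  have "2 * 1 \<le> (n + 2) * m (Suc n)" using m[of "Suc n"] by (intro mult_mono) auto
  then have "int 2 \<le> int ((Suc n + 1) * m (Suc n))" by (subst of_nat_le_iff) simp
  then have two: "2 \<le> partial_quotient x (Suc (Suc n))" using x'(4)[of "Suc n"] by simp
  have "(\<Prod>i\<le>n. real ((i + 2) * m i)) = (\<Prod>k=1..Suc n. real_of_int (int ((k + 1) * m (k - 1))))"
    by (rule prod.reindex_bij_witness[of _ "\<lambda>k. k - 1" Suc]) auto
  moreover have "partial_quotient x k < int ((k + 1) * m (k - 1)) \<and> partial_quotient y k < int ((k + 1) * m (k - 1))"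
    if "1 \<le> k" for k
    using x'(5)[of "k - 1"] y'(4)[of "k - 1"] that by simp
  ultimately show ?thesis
    using dist_ge_of_partial_quotients[OF x'(3) y'(3) eq' lt two, of "\<lambda>k. int ((k + 1) * m (k - 1))"] by simp
qed

text \<open>Offsets within the windows are chosen uniformly and independently. For a set
  \<open>U\<close>, let \<open>n\<close> be the first coordinate on which parameters hitting
  \<open>U\<close> disagree and \<open>T\<close> the values taken there: the mass is at most
  \<open>card T / (m 0 ... m n)\<close>, while the diameter is at least
  \<open>card T / (4 R^2)\<close>. Hypothesis \<open>bound\<close> is the comparison of these two;
  \<open>unbdd\<close> makes single parameters null.\<close>

lemma hausdorff_measure_window_set_pos:
  fixes m :: "nat \<Rightarrow> nat"
  assumes m: "\<And>i. m i \<ge> 1" and unbdd: "\<And>N. \<exists>i. m i \<ge> N"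
    and s: "0 \<le> s" "s \<le> 1"
    and bound: "\<And>n. real (m n) powr (1 - s) * (\<Prod>i\<le>n. real ((i + 2) * m i)) powr (2 * s)
      \<le> C * (\<Prod>i\<le>n. real (m i))"
  shows "hausdorff_measure s (window_set m) > 0"
proof -
  let ?M = "\<lambda>i. uniform_count_measure {..<m i}"
  have ne: "{..<m i} \<noteq> {}" for i using m[of i] by (auto simp: lessThan_empty_iff)
  have "prob_space (?M i)" for i
    using ne[of i] by (intro prob_space_uniform_count_measure) auto
  then interpret product_prob_space ?M UNIV
    by (simp add: product_prob_space_def product_prob_space_axioms_def product_sigma_finite_def
        prob_space_imp_sigma_finite)
  let ?P = "PiM UNIV ?M"
  have space: "w i < m i" if "w \<in> space ?P" for w i
    using that by (auto simp: space_PiM PiE_iff space_uniform_count_measure)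
  define rect where "rect n X = {w \<in> space ?P. \<forall>i\<in>{..n}. w i \<in> X i}" for n :: nat and X :: "nat \<Rightarrow> nat set"
  have rect: "rect n X \<in> sets ?P" "emeasure ?P (rect n X) = ennreal (\<Prod>i\<le>n. card (X i) / m i)"
    if "\<And>i. X i \<subseteq> {..<m i}" for n X
  proof -
    have sets: "X i \<in> sets (?M i)" for i using that by (simp add: sets_uniform_count_measure)
    show "rect n X \<in> sets ?P"
      unfolding rect_def using sets by measurable
    have "emeasure ?P (rect n X) = (\<Prod>i\<le>n. emeasure (?M i) (X i))"
      unfolding rect_def using sets by (intro emeasure_PiM_Collect) auto
    also have "\<dots> = (\<Prod>i\<le>n. ennreal (card (X i) / m i))"
      using that by (intro prod.cong) (auto simp: emeasure_uniform_count_measure)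
    also have "\<dots> = ennreal (\<Prod>i\<le>n. card (X i) / m i)" by (intro prod_ennreal) auto
    finally show "emeasure ?P (rect n X) = ennreal (\<Prod>i\<le>n. card (X i) / m i)" .
  qed
  have "\<exists>x. x \<in> window_set m \<and> (\<forall>i. partial_quotient x (Suc i) = int ((i + 1) * m i + w i))"
    if "w \<in> space ?P" for w
  proof -
    have "(i + 1) * m i + w i \<ge> 1" for i using m[of i] by simp
    then obtain x where "0 \<le> x" "x < 1" "x \<notin> \<rat>" "\<And>i. partial_quotient x (Suc i) = int ((i + 1) * m i + w i)"
      by (rule continued_fraction_exists[of "\<lambda>i. (i + 1) * m i + w i"]) blast
    then show ?thesis using space[OF that]
      by (intro exI[of _ x]) (auto simp: window_set_def algebra_simps simp flip: of_nat_mult of_nat_add)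
  qed
  then obtain g where g: "\<And>w. w \<in> space ?P \<Longrightarrow> g w \<in> window_set m"
    "\<And>w i. w \<in> space ?P \<Longrightarrow> partial_quotient (g w) (Suc i) = int ((i + 1) * m i + w i)"
    by metis
  have C: "C > 0"
  proof -
    have "0 < real (m 0) powr (1 - s) * (\<Prod>i\<le>0. real ((i + 2) * m i)) powr (2 * s)"
      using m[of 0] by simp
    also note bound[of 0]
    finally show ?thesis using m[of 0] by (simp add: zero_less_mult_iff)
  qed
  \<comment> \<open>The factor \<open>4 powr s\<close> comes from the 4 in the diameter estimate
    \<open>card T / (4 * R^2)\<close>.\<close>
  define C' where "C' = 4 powr s * C"
  have "\<exists>S\<in>sets ?P. {w \<in> space ?P. g w \<in> U} \<subseteq> S \<and> emeasure ?P S \<le> ennreal C' * diam_pow s U"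
    if U: "bounded U" for U
  proof -
    define SU where "SU = {w \<in> space ?P. g w \<in> U}"
    show ?thesis
    proof (cases "\<exists>w w' i. w \<in> SU \<and> w' \<in> SU \<and> w i \<noteq> w' i")
      case False
      show ?thesis
      proof (cases "SU = {}")
        case True
        then show ?thesis by (intro bexI[of _ "{}"]) (auto simp: SU_def)
      next
        case nonempty: False
        then obtain w where w: "w \<in> SU" "w \<in> space ?P" by (auto simp: SU_def)
        \<comment> \<open>All parameters hitting \<open>U\<close> agree, so \<open>S\<close>
          prescribes every coordinate; its mass is at most \<open>1 / m n\<close> for each
          \<open>n\<close>, hence 0.\<close>
        define S where "S = (\<Inter>n. rect n (\<lambda>i. {w i}))"
        have sub: "{w i} \<subseteq> {..<m i}" for i using space[OF w(2)] by simp
        have "S \<in> sets ?P" unfolding S_def using rect(1)[OF sub] by (intro sets.countable_INT) auto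
        moreover have "{w \<in> space ?P. g w \<in> U} \<subseteq> S"
          using False w(1) by (auto simp: S_def rect_def SU_def)
        moreover have "emeasure ?P S \<le> 0 + ennreal e" if "e > 0" for e
        proof -
          obtain n where n: "m n \<ge> nat \<lceil>1 / e\<rceil>" using unbdd by blast
          then have "1 / e \<le> m n" by linarith
          then have "1 / m n \<le> e" using that m[of n] by (simp add: field_simps)
          have "emeasure ?P S \<le> emeasure ?P (rect n (\<lambda>i. {w i}))"
            unfolding S_def using rect(1)[OF sub] by (intro emeasure_mono) auto
          also have "\<dots> = ennreal (\<Prod>i\<le>n. 1 / m i)" using rect(2)[OF sub] by simp
          also have "(\<Prod>i\<le>n. 1 / m i) = (\<Prod>i<n. 1 / m i) * (1 / m n)"
            by (simp flip: lessThan_Suc_atMost)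
          also have "\<dots> \<le> 1 * (1 / m n)"
            using m by (intro mult_right_mono prod_le_1) (auto simp: divide_le_eq Suc_le_eq)
          also have "\<dots> \<le> e" using \<open>1 / m n \<le> e\<close> by simp
          finally show ?thesis by (simp add: ennreal_leI)
        qed
        then have "emeasure ?P S \<le> 0" using ennreal_le_epsilon[of 0] by blast
        ultimately show ?thesis by (intro bexI[of _ S]) (auto simp: SU_def)
      qed
    next
      case True
      define differ where "differ i \<longleftrightarrow> (\<exists>w\<in>SU. \<exists>w'\<in>SU. w i \<noteq> w' i)" for i
      \<comment> \<open>Below \<open>n\<close> all parameters hitting \<open>U\<close> share their
        coordinates, so their points share the first \<open>n\<close> digits.\<close>
      define n where "n = (LEAST i. differ i)"
      have "\<exists>i. differ i" using True by (auto simp: differ_def)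
      then have "differ n" unfolding n_def by (rule LeastI_ex)
      then obtain v v' where v: "v \<in> SU" "v' \<in> SU" "v n \<noteq> v' n" by (auto simp: differ_def)
      have agree: "w i = w' i" if "w \<in> SU" "w' \<in> SU" "i < n" for w w' i
        using not_less_Least[of i differ] that by (auto simp: n_def differ_def)
      define T where "T = (\<lambda>w. w n) ` SU"
      have TU: "T \<subseteq> {..<m n}" using space by (auto simp: T_def SU_def)
      have "finite T" using TU finite_subset by blast
      have "v n \<in> T" "v' n \<in> T" using v by (auto simp: T_def)
      then have "Min T \<in> T" "Max T \<in> T" using \<open>finite T\<close> by (auto intro: Min_in Max_in)
      then obtain p q where p: "p \<in> SU" "p n = Min T" and q: "q \<in> SU" "q n = Max T"
        by (auto simp: T_def)
      have "p n < q n"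
        using Min_le[OF \<open>finite T\<close> \<open>v n \<in> T\<close>] Min_le[OF \<open>finite T\<close> \<open>v' n \<in> T\<close>]
          Max_ge[OF \<open>finite T\<close> \<open>v n \<in> T\<close>] Max_ge[OF \<open>finite T\<close> \<open>v' n \<in> T\<close>] v(3)
        unfolding p q by linarith
      have "T \<subseteq> {p n..q n}" using \<open>finite T\<close> unfolding p q by auto
      then have "card T \<le> card {p n..q n}" by (intro card_mono) auto
      \<comment> \<open>At most \<open>q n - p n + 1\<close> values fit between the extremes, and
        the extra 1 is absorbed because \<open>p n < q n\<close>.\<close>
      then have cardT: "card T \<le> 2 * (q n - p n)" using \<open>p n < q n\<close> by simp
      have "card T > 0" using \<open>finite T\<close> \<open>v n \<in> T\<close> by (auto simp: card_gt_0_iff)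
      have "card T \<le> m n" using card_mono[OF _ TU] by simp
      define R where "R = (\<Prod>i\<le>n. real ((i + 2) * m i))"
      have sp: "p \<in> space ?P" "q \<in> space ?P" using p q by (auto simp: SU_def)
      have "R > 0"
        unfolding R_def
      proof (intro prod_pos)
        fix i
        have "0 < (i + 2) * m i" using m[of i] by simp
        then show "0 < real ((i + 2) * m i)" by (simp only: of_nat_0_less_iff)
      qed
      have "real (card T) / (4 * R\<^sup>2) \<le> (real (q n) - real (p n)) / (2 * R\<^sup>2)"
      proof -
        have "card T + 2 * p n \<le> 2 * q n" using cardT \<open>p n < q n\<close> by simp
        then have "real (card T + 2 * p n) \<le> real (2 * q n)" by (simp only: of_nat_le_iff)
        then have "real (card T) \<le> 2 * (real (q n) - real (p n))" by simp
        then show ?thesis using \<open>R > 0\<close> by (simp add: divide_simps)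
      qed
      also have "\<dots> = (partial_quotient (g q) (Suc n) - partial_quotient (g p) (Suc n)) / (2 * R\<^sup>2)"
        using g(2) sp by simp
      also have "\<dots> \<le> \<bar>g p - g q\<bar>"
        using g sp agree[OF p(1) q(1)] \<open>p n < q n\<close>
        unfolding R_def by (intro window_set_dist_ge m) auto
      also have "\<dots> \<le> diameter U"
        using diameter_bounded_bound[OF U, of "g p" "g q"] p q by (simp add: SU_def dist_real_def)
      finally have diam: "real (card T) / (4 * R\<^sup>2) \<le> diameter U" .
      \<comment> \<open>\<open>rect n X\<close> inspects coordinates up to \<open>n\<close> only;
        \<open>{}\<close> beyond is a default that satisfies the inclusion in
        \<open>{..<m i}\<close>.\<close>
      define X where "X i = (if i < n then {p i} else if i = n then T else {})" for i
      have X: "X i \<subseteq> {..<m i}" for i using TU space[OF sp(1)] by (auto simp: X_def)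
      have "{w \<in> space ?P. g w \<in> U} \<subseteq> rect n X"
      proof
        fix w assume w: "w \<in> {w \<in> space ?P. g w \<in> U}"
        then have "w \<in> SU" by (simp add: SU_def)
        then have "w n \<in> T" "\<And>i. i < n \<Longrightarrow> w i = p i" using agree p(1) by (auto simp: T_def)
        then show "w \<in> rect n X" using w by (auto simp: rect_def X_def)
      qed
      moreover have "emeasure ?P (rect n X) \<le> ennreal C' * diam_pow s U"
      proof -
        have "(\<Prod>i\<le>n. card (X i) / m i) = (\<Prod>i\<le>n. real (card (X i))) / (\<Prod>i\<le>n. real (m i))"
          by (simp add: prod_dividef)
        also have "(\<Prod>i\<le>n. real (card (X i))) = card T"
          by (simp add: X_def flip: lessThan_Suc_atMost)
        finally have mass: "(\<Prod>i\<le>n. card (X i) / m i) = card T / (\<Prod>i\<le>n. real (m i))" .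
        let ?c = "real (card T)"
        have Ppos: "(\<Prod>i\<le>n. real (m i)) > 0"
        proof (intro prod_pos)
          fix i show "0 < real (m i)" using m[of i] by simp
        qed
        \<comment> \<open>Splitting off \<open>?c powr s\<close> matches the diameter; the rest is
          bounded by \<open>m n powr (1 - s)\<close>, which is where \<open>s <= 1\<close>
          enters.\<close>
        have "?c * R powr (2 * s) = ?c powr s * (?c powr (1 - s) * R powr (2 * s))"
        proof -
          have "?c = ?c powr s * ?c powr (1 - s)" using \<open>card T > 0\<close> by (simp flip: powr_add)
          then show ?thesis by (metis mult.assoc)
        qed
        also have "\<dots> \<le> ?c powr s * (real (m n) powr (1 - s) * R powr (2 * s))"
          using \<open>card T \<le> m n\<close> s by (intro mult_left_mono mult_right_mono powr_mono2) auto
        also have "\<dots> \<le> ?c powr s * (C * (\<Prod>i\<le>n. real (m i)))"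
          using bound[of n] by (intro mult_left_mono) (auto simp: R_def)
        finally have key: "?c * R powr (2 * s) \<le> ?c powr s * (C * (\<Prod>i\<le>n. real (m i)))" .
        have "u / P \<le> C * (k / r)" if "u * r \<le> k * (C * P)" "P > 0" "r > 0" for u r k P
          using that by (simp add: field_simps)
        from this[OF key Ppos] have "?c / (\<Prod>i\<le>n. real (m i)) \<le> C * (?c powr s / R powr (2 * s))"
          using \<open>R > 0\<close> by simp
        also have "?c powr s / R powr (2 * s) = 4 powr s * (?c / (4 * R\<^sup>2)) powr s"
        proof -
          have "R\<^sup>2 = R powr 2" using \<open>R > 0\<close> by simp
          then have "R\<^sup>2 powr s = R powr (2 * s)" by (simp only: powr_powr)
          then show ?thesis by (simp add: powr_divide powr_mult)
        qed
        also have "C * (4 powr s * (?c / (4 * R\<^sup>2)) powr s) \<le> C' * diameter U powr s"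
        proof -
          have "(?c / (4 * R\<^sup>2)) powr s \<le> diameter U powr s" using diam s by (intro powr_mono2) auto
          then show ?thesis using C by (simp add: C'_def mult_ac)
        qed
        finally have le: "?c / (\<Prod>i\<le>n. real (m i)) \<le> C' * diameter U powr s" .
        have "U \<noteq> {}" using p by (auto simp: SU_def)
        moreover have "diameter U > 0"
          using diam \<open>card T > 0\<close> \<open>R > 0\<close> by (intro less_le_trans[OF _ diam]) simp
        ultimately have "diam_pow s U = ennreal (diameter U powr s)" by (simp add: diam_pow_def)
        then have "ennreal C' * diam_pow s U = ennreal (C' * diameter U powr s)"
          using C by (simp add: ennreal_mult C'_def)
        then show ?thesis using rect(2)[OF X] mass le by (simp add: ennreal_leI)
      qed
      ultimately show ?thesis using rect(1)[OF X] by blast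
    qed
  qed
  moreover have "emeasure ?P (space ?P) > 0" by (simp add: emeasure_space_1)
  ultimately show ?thesis
    using g(1) by (intro mass_distribution[of ?P "ennreal C'" g]) auto
qed

subsection \<open>The dimension of the growth set\<close>

text \<open>If the inequality failed from \<open>N\<close> on, each new digit would multiply
  \<open>ln (Q n)\<close> by at most \<open>c\<close>. Then \<open>ln (a n) <= L c^n\<close>, which
  keeps \<open>\<phi> n\<close> eventually below \<open>b^n\<close>.\<close>

lemma frequently_partial_quotient_ge:
  assumes x: "x \<in> E_set \<phi>" and pos: "\<And>n. n \<ge> 1 \<Longrightarrow> \<phi> n > 0"
    and c: "1 < c" "c < b" and freq: "\<exists>\<^sub>F n in sequentially. b ^ n \<le> \<phi> n"
  shows "\<exists>\<^sub>F n in sequentially.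
    (\<Prod>k=1..n. real_of_int (partial_quotient x k)) powr (c - 1) \<le> partial_quotient x (Suc n)"
proof (rule ccontr)
  define a where "a k = real_of_int (partial_quotient x k)" for k
  define Q where "Q n = (\<Prod>k=1..n. a k)" for n
  assume "\<not> ?thesis"
  then have "\<forall>\<^sub>F n in sequentially. a (Suc n) < Q n powr (c - 1)"
    by (simp add: not_frequently not_le a_def Q_def)
  then obtain N where N: "\<And>n. n \<ge> N \<Longrightarrow> a (Suc n) < Q n powr (c - 1)"
    by (auto simp: eventually_sequentially)
  have a1: "a k \<ge> 1" if "k \<ge> 1" for k
    using partial_quotient_pos[of x k] x that by (simp add: a_def E_set_def Lambda_set_def)
  have Q1: "Q n \<ge> 1" for n unfolding Q_def using a1 by (intro prod_ge_1) auto
  have Q_Suc: "Q (Suc n) = Q n * a (Suc n)" for n by (simp add: Q_def)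
  define L where "L = ln (Q N)"
  have "ln (Q (N + j)) \<le> L * c ^ j" for j
  proof (induction j)
    case (Suc j)
    have "ln (a (Suc (N + j))) \<le> (c - 1) * ln (Q (N + j))"
      using N[of "N + j"] a1[of "Suc (N + j)"] Q1[of "N + j"]
      by (simp flip: ln_powr)
    then have "ln (Q (N + Suc j)) \<le> c * ln (Q (N + j))"
      using Q1[of "N + j"] a1[of "Suc (N + j)"] by (simp add: Q_Suc ln_mult algebra_simps)
    also have "\<dots> \<le> c * (L * c ^ j)" using Suc c by (intro mult_left_mono) auto
    finally show ?case by (simp add: mult_ac)
  qed (simp add: L_def)
  moreover have "ln (a n) \<le> ln (Q n)" if "n \<ge> 1" for n
    using Q_Suc[of "n - 1"] Q1[of "n - 1"] a1[OF that] that by (simp add: mult_le_cancel_right1)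
  ultimately have upper: "ln (a n) \<le> L * c ^ n" if "n \<ge> N" "n \<ge> 1" for n
  proof -
    have "L \<ge> 0" using Q1[of N] by (simp add: L_def)
    then have "L * c ^ (n - N) \<le> L * c ^ n" using c by (intro mult_left_mono power_increasing) auto
    moreover have "ln (Q n) \<le> L * c ^ (n - N)"
      using \<open>\<And>j. ln (Q (N + j)) \<le> L * c ^ j\<close>[of "n - N"] that by simp
    ultimately show ?thesis using \<open>\<And>n. n \<ge> 1 \<Longrightarrow> ln (a n) \<le> ln (Q n)\<close>[OF that(2)] by linarith
  qed
  \<comment> \<open>Any constant strictly between 0 and 1 would serve. The resulting factor
    \<open>2 * L\<close> is absorbed by \<open>(c / b) ^ n\<close>.\<close>
  have "ereal (1/2) < liminf (\<lambda>n. ereal (ln (a n) / \<phi> n))"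
    using x by (simp add: E_set_def a_def one_ereal_def)
  then have "\<forall>\<^sub>F n in sequentially. ereal (1/2) < ereal (ln (a n) / \<phi> n)"
    by (rule less_LiminfD)
  moreover have "(\<lambda>n. (c / b) ^ n * (2 * L)) \<longlonglongrightarrow> 0"
    using c by (intro tendsto_mult_left_zero LIMSEQ_realpow_zero) auto
  then have "\<forall>\<^sub>F n in sequentially. (c / b) ^ n * (2 * L) < 1"
    by (rule order_tendstoD) simp
  ultimately have "\<forall>\<^sub>F n in sequentially. \<phi> n < b ^ n"
    using eventually_ge_at_top[of N] eventually_ge_at_top[of 1]
  proof eventually_elim
    case (elim n)
    have "\<phi> n < 2 * ln (a n)" using elim(1) pos[OF elim(4)] by (simp add: field_simps)
    also have "\<dots> \<le> 2 * (L * c ^ n)" using upper elim by simp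
    also have "\<dots> \<le> b ^ n" using elim(2) c by (simp add: power_divide field_simps)
    finally show ?case .
  qed
  with freq show False by (simp add: frequently_def not_le)
qed

text \<open>For \<open>c = 1\<close> the exponent \<open>c - 1\<close> vanishes, the digit condition
  reads \<open>1 <= a_(n+1)\<close>, and full cylinders are used at every level.\<close>

lemma hausdorff_measure_E_set_eq_0:
  assumes pos: "\<And>n. n \<ge> 1 \<Longrightarrow> \<phi> n > 0"
    and c: "c = 1 \<or> 1 < c \<and> c < b \<and> (\<exists>\<^sub>F n in sequentially. b ^ n \<le> \<phi> n)"
    and s: "s > 1 / (c + 1)"
  shows "hausdorff_measure s (E_set \<phi>) = 0"
proof (rule hausdorff_measure_limsup_cylinders[OF _ s])
  show "c \<ge> 1" using c by auto
next
  fix x assume x: "x \<in> E_set \<phi>"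
  then show irr: "0 \<le> x \<and> x < 1 \<and> x \<notin> \<rat>" and "filterlim (partial_quotient x) at_top sequentially"
    by (auto simp: E_set_def Lambda_set_def)
  show "\<exists>\<^sub>F n in sequentially.
      (\<Prod>k=1..n. real_of_int (partial_quotient x k)) powr (c - 1) \<le> partial_quotient x (Suc n)"
  proof (cases "c = 1")
    case True
    have "(\<Prod>k=1..n. real_of_int (partial_quotient x k)) powr (c - 1) \<le> partial_quotient x (Suc n)" for n
      using True irr partial_quotient_pos[of x "Suc n"] by simp
    then show ?thesis by (intro eventually_frequently always_eventually) auto
  qed (use c frequently_partial_quotient_ge[OF x pos] in auto)
qed

section \<open>Lower bound for the growth set\<close>

lemma sum_bounded_above_of_eventually_nonpos:
  fixes f :: "nat \<Rightarrow> real"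
  assumes "eventually (\<lambda>i. f i \<le> 0) sequentially"
  obtains C where "\<And>n. (\<Sum>i<n. f i) \<le> C"
proof -
  obtain N where N: "\<And>i. i \<ge> N \<Longrightarrow> f i \<le> 0" using assms by (auto simp: eventually_sequentially)
  have "(\<Sum>i<n. f i) \<le> (\<Sum>i<N. max 0 (f i))" for n
  proof -
    have "(\<Sum>i<n. f i) \<le> (\<Sum>i<n. max 0 (f i))" by (intro sum_mono) auto
    also have "\<dots> = (\<Sum>i\<in>{..<n} \<inter> {..<N}. max 0 (f i))"
    proof (intro sum.mono_neutral_right ballI)
      fix i assume "i \<in> {..<n} - {..<n} \<inter> {..<N}"
      then have "f i \<le> 0" by (intro N) auto
      then show "max 0 (f i) = 0" by simp
    qed auto
    also have "\<dots> \<le> (\<Sum>i<N. max 0 (f i))" by (intro sum_mono2) auto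
    finally show ?thesis .
  qed
  then show thesis by (rule that)
qed

text \<open>When the suprema are finite and \<open>b > 0\<close>, this is the least majorant of
  \<open>\<phi>\<close> that grows by at most the factor \<open>b\<close> per step.\<close>

definition envelope :: "real \<Rightarrow> (nat \<Rightarrow> real) \<Rightarrow> nat \<Rightarrow> real" where
  "envelope b \<phi> n = (SUP j. \<phi> (n + j) / b ^ j)"

text \<open>The suprema are finite because \<open>\<phi> n / b^n\<close> is bounded. Equality at
  \<open>n\<close> means that \<open>\<phi> n / b^n\<close> is not exceeded later on, and a positive
  null sequence has such indices arbitrarily far out.\<close>

lemma envelope:
  fixes \<phi> :: "nat \<Rightarrow> real"
  assumes pos: "\<And>n. n \<ge> 1 \<Longrightarrow> \<phi> n > 0" and mono: "mono_on {1..} \<phi>" and "b > 1"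
    and lim: "(\<lambda>n. \<phi> n / b ^ n) \<longlonglongrightarrow> 0"
  shows envelope_ge: "n \<ge> 1 \<Longrightarrow> \<phi> n \<le> envelope b \<phi> n"
    and envelope_Suc_le: "n \<ge> 1 \<Longrightarrow> envelope b \<phi> (Suc n) \<le> b * envelope b \<phi> n"
    and envelope_mono: "n \<ge> 1 \<Longrightarrow> envelope b \<phi> n \<le> envelope b \<phi> (Suc n)"
    and envelope_frequently_eq: "\<exists>\<^sub>F n in sequentially. envelope b \<phi> n = \<phi> n"
proof -
  have "Bseq (\<lambda>n. \<phi> n / b ^ n)" using lim by (intro convergent_imp_Bseq convergentI)
  then obtain D where D: "\<And>n. \<bar>\<phi> n / b ^ n\<bar> \<le> D" by (auto simp: Bseq_def)
  have bdd: "bdd_above (range (\<lambda>j. \<phi> (n + j) / b ^ j))" for n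
  proof (rule bdd_aboveI2)
    fix j
    have "\<phi> (n + j) / b ^ (n + j) \<le> D" using D[of "n + j"] by linarith
    moreover have "\<phi> (n + j) / b ^ j = (\<phi> (n + j) / b ^ (n + j)) * b ^ n" using \<open>b > 1\<close> by (simp add: power_add)
    ultimately show "\<phi> (n + j) / b ^ j \<le> D * b ^ n" using \<open>b > 1\<close> by (metis less_imp_le mult_right_mono order_trans zero_le_one zero_le_power)
  qed
  have upper: "\<phi> (n + j) / b ^ j \<le> envelope b \<phi> n" for n j
    unfolding envelope_def by (intro cSUP_upper bdd) simp
  show ge: "\<phi> n \<le> envelope b \<phi> n" if "n \<ge> 1" for n
    using upper[of n 0] by simp
  show "envelope b \<phi> (Suc n) \<le> b * envelope b \<phi> n" if "n \<ge> 1" for n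
    unfolding envelope_def[of b \<phi> "Suc n"]
  proof (intro cSUP_least)
    fix j
    show "\<phi> (Suc n + j) / b ^ j \<le> b * envelope b \<phi> n"
      using upper[of n "Suc j"] \<open>b > 1\<close> by (simp add: field_simps)
  qed simp
  show "envelope b \<phi> n \<le> envelope b \<phi> (Suc n)" if "n \<ge> 1" for n
    unfolding envelope_def[of b \<phi> n]
  proof (intro cSUP_least)
    fix j
    have "\<phi> (n + j) \<le> \<phi> (Suc n + j)" using mono that by (auto simp: mono_on_def)
    then have "\<phi> (n + j) / b ^ j \<le> \<phi> (Suc n + j) / b ^ j" using \<open>b > 1\<close> by (intro divide_right_mono) auto
    also have "\<dots> \<le> envelope b \<phi> (Suc n)" by (rule upper)
    finally show "\<phi> (n + j) / b ^ j \<le> envelope b \<phi> (Suc n)" .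
  qed simp
  show "\<exists>\<^sub>F n in sequentially. envelope b \<phi> n = \<phi> n"
    unfolding frequently_sequentially
  proof
    fix N :: nat
    define N' where "N' = max N 1"
    define r where "r n = \<phi> n / b ^ n" for n
    have "r N' > 0" using pos[of N'] \<open>b > 1\<close> by (simp add: r_def N'_def)
    then have "\<forall>\<^sub>F n in sequentially. r n < r N'"
      using lim unfolding r_def by (intro order_tendstoD(2)) auto
    then obtain K where K: "\<And>n. n \<ge> K \<Longrightarrow> r n < r N'" by (auto simp: eventually_sequentially)
    \<comment> \<open>Beyond \<open>N' + K\<close> all values are below \<open>r N'\<close>, so the
      maximum over this finite range is one over all \<open>n >= N'\<close>.\<close>
    have "Max (r ` {N'..N' + K}) \<in> r ` {N'..N' + K}" by (intro Max_in) auto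
    then obtain k where k_max: "k \<in> {N'..N' + K}" "r k = Max (r ` {N'..N' + K})" by (metis imageE)
    have k: "k \<in> {N'..N' + K}" "\<And>n. n \<in> {N'..N' + K} \<Longrightarrow> r n \<le> r k"
      unfolding k_max(2) using k_max(1) by auto
    have max: "r n \<le> r k" if "n \<ge> N'" for n
    proof (cases "n \<le> N' + K")
      case False
      then have "r n \<le> r N'" using K[of n] by simp
      also have "\<dots> \<le> r k" by (rule k(2)) auto
      finally show ?thesis .
    qed (use k that in auto)
    have "envelope b \<phi> k \<le> \<phi> k"
      unfolding envelope_def
    proof (intro cSUP_least)
      fix j
      have "r (k + j) \<le> r k" using k(1) by (intro max) auto
      then show "\<phi> (k + j) / b ^ j \<le> \<phi> k"
        using \<open>b > 1\<close> by (simp add: r_def power_add field_simps)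
    qed simp
    moreover have "k \<ge> 1" "k \<ge> N" using k(1) by (auto simp: N'_def)
    ultimately show "\<exists>n\<ge>N. envelope b \<phi> n = \<phi> n" using ge[of k] by force
  qed
qed

text \<open>After taking logarithms the top index contributes an excess
  \<open>s ln (m n) <= s p n\<close>. By the growth condition this is at most \<open>s p 0\<close>
  plus \<open>s (b - 1)\<close> times the earlier sum of \<open>p\<close>. The earlier indices have
  slack \<open>1 - 2 s\<close>, so \<open>\<kappa> = 1 - s (b + 1) > 0\<close> remains to absorb the
  terms \<open>ln (i + 3) + 1\<close>.\<close>

lemma window_bound:
  fixes p :: "nat \<Rightarrow> real" and m :: "nat \<Rightarrow> nat"
  assumes m: "\<And>i. m i \<ge> 1" "\<And>i. ln (m i) \<le> p i" "\<And>i. p i - 1 \<le> ln (m i)"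
    and step: "\<And>i. p (Suc i) \<le> b * p i"
    and b: "b \<ge> 1" and s: "0 \<le> s" "s < 1 / (b + 1)"
    and log: "\<And>\<kappa>. \<kappa> > 0 \<Longrightarrow> eventually (\<lambda>i. ln (real (i + 3)) + 1 \<le> \<kappa> * p i) sequentially"
  obtains C where "\<And>n. real (m n) powr (1 - s) * (\<Prod>i\<le>n. real ((i + 2) * m i)) powr (2 * s)
      \<le> C * (\<Prod>i\<le>n. real (m i))"
proof -
  have s': "s * (b + 1) < 1" using s b by (simp add: field_simps)
  have "s * 2 \<le> s * (b + 1)" using s(1) b by (intro mult_left_mono) auto
  then have s2: "2 * s < 1" using s' by simp
  define \<kappa> where "\<kappa> = 1 - s * (b + 1)"
  have "eventually (\<lambda>i. ln (real (i + 3)) + 1 - \<kappa> * p i \<le> 0) sequentially"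
    using log[of \<kappa>] s' by (auto simp: \<kappa>_def elim: eventually_mono)
  then obtain C0 where C0: "\<And>n. (\<Sum>i<n. ln (real (i + 3)) + 1 - \<kappa> * p i) \<le> C0"
    by (rule sum_bounded_above_of_eventually_nonpos) blast
  \<comment> \<open>Telescoping of \<open>p (Suc i) - p i <= (b - 1) * p i\<close>.\<close>
  have pn: "p n \<le> p 0 + (b - 1) * (\<Sum>i<n. p i)" for n
  proof (induction n)
    case (Suc n)
    then show ?case using step[of n] by (simp add: algebra_simps)
  qed simp
  define C where "C = s * p 0 + C0 + ln 2"
  have "real (m n) powr (1 - s) * (\<Prod>i\<le>n. real ((i + 2) * m i)) powr (2 * s)
      \<le> exp C * (\<Prod>i\<le>n. real (m i))" for n
  proof -
    have mp: "real (m i) > 0" for i using m(1)[of i] by simp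
    let ?l = "\<lambda>i. ln (real (m i))"
    have "(\<Prod>i\<le>n. real ((i + 2) * m i)) = exp (\<Sum>i\<le>n. ln (real (i + 2)) + ?l i)"
      using mp by (simp add: exp_sum exp_add algebra_simps)
    then have "(\<Prod>i\<le>n. real ((i + 2) * m i)) powr (2 * s) = exp (2 * s * (\<Sum>i\<le>n. ln (real (i + 2)) + ?l i))"
      by (simp add: powr_def)
    moreover have "real (m n) powr (1 - s) = exp ((1 - s) * ?l n)" using mp[of n] by (simp add: powr_def)
    moreover have "(\<Prod>i\<le>n. real (m i)) = exp (\<Sum>i\<le>n. ?l i)" using mp by (simp add: exp_sum)
    moreover have "(1 - s) * ?l n + 2 * s * (\<Sum>i\<le>n. ln (real (i + 2)) + ?l i) \<le> C + (\<Sum>i\<le>n. ?l i)"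
    proof -
      \<comment> \<open>Peeling off the first term shifts the index, so that all error terms are
        summed over \<open>i < n\<close> like the available slack.\<close>
      have "(\<Sum>i\<le>n. ln (real (i + 2))) = ln 2 + (\<Sum>i<n. ln (real (i + 3)))"
        by (simp add: sum.atMost_shift add.commute numeral_eq_Suc)
      then have A: "2 * s * (\<Sum>i\<le>n. ln (real (i + 2))) \<le> ln 2 + (\<Sum>i<n. ln (real (i + 3)))"
      proof -
        have "(\<Sum>i<n. ln (real (i + 3))) \<ge> 0" by (intro sum_nonneg) auto
        then have "2 * s * (ln 2 + (\<Sum>i<n. ln (real (i + 3)))) \<le> 1 * (ln 2 + (\<Sum>i<n. ln (real (i + 3))))"
          using s2 by (intro mult_right_mono) auto
        then show ?thesis using \<open>(\<Sum>i\<le>n. ln (real (i + 2))) = ln 2 + (\<Sum>i<n. ln (real (i + 3)))\<close> by simp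
      qed
      have "(\<Sum>i<n. p i - 1) \<le> (\<Sum>i<n. ?l i)" using m(3) by (intro sum_mono)
      then have "(1 - 2 * s) * (\<Sum>i<n. p i - 1) \<le> (1 - 2 * s) * (\<Sum>i<n. ?l i)"
        using s2 by (intro mult_left_mono) auto
      moreover have "(1 - 2 * s) * (\<Sum>i<n. p i - 1) = (1 - 2 * s) * (\<Sum>i<n. p i) - (1 - 2 * s) * n"
        by (simp add: sum_subtractf algebra_simps)
      moreover have "(1 - 2 * s) * n \<le> 1 * real n" using s by (intro mult_right_mono) auto
      ultimately have B: "(1 - 2 * s) * (\<Sum>i<n. p i) - n \<le> (1 - 2 * s) * (\<Sum>i<n. ?l i)"
        by linarith
      have "s * ?l n \<le> s * p n" using m(2) s by (intro mult_left_mono) auto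
      also have "\<dots> \<le> s * (p 0 + (b - 1) * (\<Sum>i<n. p i))" using pn s by (intro mult_left_mono) auto
      finally have D: "s * ?l n \<le> s * p 0 + s * (b - 1) * (\<Sum>i<n. p i)" by (simp add: algebra_simps)
      have E: "(\<Sum>i<n. ln (real (i + 3))) + n - \<kappa> * (\<Sum>i<n. p i) \<le> C0"
        using C0[of n] by (simp add: sum.distrib sum_subtractf sum_distrib_left)
      have "\<kappa> * (\<Sum>i<n. p i) = (1 - 2 * s) * (\<Sum>i<n. p i) - s * (b - 1) * (\<Sum>i<n. p i)"
        by (simp add: \<kappa>_def algebra_simps)
      then have "s * ?l n + 2 * s * (\<Sum>i\<le>n. ln (real (i + 2))) \<le> C + (1 - 2 * s) * (\<Sum>i<n. ?l i)"
        using A B D E by (simp add: C_def)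
      then show ?thesis
        by (simp add: sum.distrib algebra_simps flip: lessThan_Suc_atMost)
    qed
    ultimately show ?thesis by (simp flip: exp_add)
  qed
  then show thesis by (rule that)
qed

text \<open>The liminf needs a lower bound at almost all \<open>n\<close>, given by
  \<open>\<psi> >= \<phi>\<close>, but an upper bound only at infinitely many, namely those with
  \<open>\<psi> n = \<phi> n\<close>. The window factor \<open>n + 1\<close> is negligible there by
  \<open>lim\<close>.\<close>

lemma window_set_subset_E_set:
  fixes \<phi> \<psi> :: "nat \<Rightarrow> real"
  assumes pos: "\<And>n. n \<ge> 1 \<Longrightarrow> \<phi> n > 0"
    and ge: "\<And>n. n \<ge> 1 \<Longrightarrow> \<phi> n \<le> \<psi> n"
    and mono: "\<And>n. n \<ge> 1 \<Longrightarrow> \<psi> n \<le> \<psi> (Suc n)"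
    and freq: "\<exists>\<^sub>F n in sequentially. \<psi> n = \<phi> n"
    and lim: "(\<lambda>n. ln (real (n + 1)) / \<phi> n) \<longlonglongrightarrow> 0"
  shows "window_set (\<lambda>i. nat \<lfloor>exp (\<psi> (Suc i))\<rfloor>) \<subseteq> E_set \<phi>"
proof
  define m where "m i = nat \<lfloor>exp (\<psi> (Suc i))\<rfloor>" for i
  fix x assume "x \<in> window_set (\<lambda>i. nat \<lfloor>exp (\<psi> (Suc i))\<rfloor>)"
  then have x: "0 \<le> x" "x < 1" "x \<notin> \<rat>" "\<And>i. int ((i + 1) * m i) \<le> partial_quotient x (Suc i)"
    "\<And>i. partial_quotient x (Suc i) < int ((i + 2) * m i)"
    by (auto simp: window_set_def m_def)
  have exp1: "exp (\<psi> (Suc i)) \<ge> 1" for i using pos[of "Suc i"] ge[of "Suc i"] by simp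
  have rm: "real (m i) = of_int \<lfloor>exp (\<psi> (Suc i))\<rfloor>" for i by (simp add: m_def)
  have m1: "m i \<ge> 1" for i using exp1[of i] by (simp add: m_def le_nat_floor)
  have m_mono: "m i \<le> m (Suc i)" for i
    unfolding m_def using mono[of "Suc i"] by (intro nat_mono floor_mono) simp
  have ge_n: "int n \<le> partial_quotient x n" if "n \<ge> 1" for n
  proof -
    have "n * 1 \<le> n * m (n - 1)" using m1 by (intro mult_left_mono) auto
    then have "int n \<le> int (n * m (n - 1))" by (simp only: of_nat_le_iff mult_1_right)
    also have "\<dots> \<le> partial_quotient x n" using x(4)[of "n - 1"] that by simp
    finally show ?thesis .
  qed
  have "partial_quotient x n \<le> partial_quotient x (Suc n)" if "n \<ge> 1" for n
  proof -
    obtain i where i: "n = Suc i" using \<open>n \<ge> 1\<close> by (cases n) auto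
    have "(i + 2) * m i \<le> (Suc i + 1) * m (Suc i)" using m_mono[of i] by (intro mult_mono) auto
    then show ?thesis using x(5)[of i] x(4)[of "Suc i"] unfolding i by linarith
  qed
  then have inc: "partial_quotient x (Suc i) \<le> partial_quotient x (Suc j)" if "i \<le> j" for i j
    using lift_Suc_mono_le[of "\<lambda>i. partial_quotient x (Suc i)", OF _ that] by simp
  have mono_pq: "mono_on {1..} (partial_quotient x)"
  proof (rule mono_onI)
    fix r s :: nat assume "r \<in> {1..}" "s \<in> {1..}" "r \<le> s"
    then show "partial_quotient x r \<le> partial_quotient x s" using inc[of "r - 1" "s - 1"] by simp
  qed
  have "filterlim (partial_quotient x) at_top sequentially"
    by (rule filterlim_at_top_mono[OF filterlim_int_sequentially eventually_sequentiallyI[of 1]])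
       (rule ge_n)
  then have Lam: "x \<in> Lambda_set" using x mono_pq by (simp add: Lambda_set_def)
  let ?r = "\<lambda>n. ln (real_of_int (partial_quotient x n)) / \<phi> n"
  \<comment> \<open>For \<open>n >= 2\<close> the factor \<open>n\<close> of the window makes up for
    the floor: \<open>exp (\<psi> n) < m + 1 <= 2 m <= n m\<close>.\<close>
  have lower: "1 \<le> ?r n" if "n \<ge> 2" for n
  proof -
    obtain i where i: "n = Suc i" using \<open>n \<ge> 2\<close> by (cases n) auto
    have "exp (\<psi> n) < real (m i) + 1" unfolding rm i by linarith
    then have "exp (\<psi> n) \<le> 2 * real (m i)" using m1[of i] by simp
    also have "\<dots> \<le> real n * real (m i)" using that by (intro mult_right_mono) auto
    also have "\<dots> \<le> real_of_int (partial_quotient x n)"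
    proof -
      have "real_of_int (int ((i + 1) * m i)) \<le> real_of_int (partial_quotient x n)"
        using x(4)[of i] by (simp only: i of_int_le_iff)
      then show ?thesis by (simp add: i algebra_simps)
    qed
    finally have "\<psi> n \<le> ln (real_of_int (partial_quotient x n))"
      using ge_n[of n] that by (simp add: ln_ge_iff)
    then show ?thesis using ge[of n] pos[of n] that by (simp add: le_divide_eq)
  qed
  have upper: "?r n \<le> 1 + ln (real (n + 1)) / \<phi> n" if "n \<ge> 1" "\<psi> n = \<phi> n" for n
  proof -
    obtain i where i: "n = Suc i" using \<open>n \<ge> 1\<close> by (cases n) auto
    have "real_of_int (partial_quotient x n) \<le> real (n + 1) * real (m i)"
    proof -
      have "real_of_int (partial_quotient x n) < real_of_int (int ((i + 2) * m i))"
        using x(5)[of i] by (simp only: i of_int_less_iff)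
      then show ?thesis by (simp add: i algebra_simps)
    qed
    also have "\<dots> \<le> real (n + 1) * exp (\<phi> n)"
      using that by (intro mult_left_mono) (auto simp: rm i)
    finally have "ln (real_of_int (partial_quotient x n)) \<le> ln (real (n + 1) * exp (\<phi> n))"
      using ge_n[OF that(1)] that(1) by (intro ln_mono) auto
    also have "\<dots> = ln (real (n + 1)) + \<phi> n" by (simp add: ln_mult)
    finally show ?thesis using pos[OF that(1)] by (simp add: field_simps)
  qed
  have "liminf (\<lambda>n. ereal (?r n)) = 1"
  proof (rule antisym)
    show "1 \<le> liminf (\<lambda>n. ereal (?r n))"
      using lower by (intro Liminf_bounded) (auto simp: eventually_sequentially one_ereal_def)
    show "liminf (\<lambda>n. ereal (?r n)) \<le> 1"
    proof (rule ccontr)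
      assume "\<not> liminf (\<lambda>n. ereal (?r n)) \<le> 1"
      then obtain c where c: "1 < ereal c" "ereal c < liminf (\<lambda>n. ereal (?r n))"
        using ereal_dense2[of 1] by (auto simp: not_le)
      have "\<forall>\<^sub>F n in sequentially. ereal c < ereal (?r n)" using c(2) by (rule less_LiminfD)
      moreover have "\<forall>\<^sub>F n in sequentially. ln (real (n + 1)) / \<phi> n < c - 1"
        using lim c(1) by (intro order_tendstoD(2)) (auto simp: one_ereal_def)
      ultimately have "\<forall>\<^sub>F n in sequentially. \<psi> n \<noteq> \<phi> n"
        using eventually_ge_at_top[of 1]
      proof eventually_elim
        case (elim n)
        show ?case using upper[OF elim(3)] elim(1,2) by auto
      qed
      with freq show False by (simp add: frequently_def)
    qed
  qed
  with Lam show "x \<in> E_set \<phi>" by (simp add: E_set_def)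
qed

lemma eventually_ln_le:
  fixes \<phi> :: "nat \<Rightarrow> real"
  assumes "filterlim (\<lambda>n. \<phi> n / ln (real n)) at_top sequentially" "\<kappa> > 0"
  shows "eventually (\<lambda>n. ln (real (n + 2)) + 1 \<le> \<kappa> * \<phi> n) sequentially"
proof -
  \<comment> \<open>The 3 arises because \<open>n >= 3\<close> gives \<open>n + 2 <= n^2\<close> and
    \<open>ln n >= 1\<close>, so \<open>ln (n + 2) + 1 <= 3 ln n\<close>.\<close>
  have "eventually (\<lambda>n. 3 / \<kappa> \<le> \<phi> n / ln (real n)) sequentially"
    using assms(1) by (auto simp: filterlim_at_top)
  then show ?thesis using eventually_ge_at_top[of 3]
  proof eventually_elim
    case (elim n)
    have "ln (real n) \<ge> 1"
    proof -
      have "exp 1 \<le> (3::real)" by (rule exp_le)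
      then have "exp 1 \<le> real n" using elim(2) by linarith
      then show ?thesis using elim(2) by (subst ln_ge_iff) auto
    qed
    have "real (n + 2) \<le> real n * real n"
    proof -
      have "n + 2 \<le> 3 * n" using elim by simp
      also have "\<dots> \<le> n * n" using elim by (intro mult_right_mono) auto
      finally show ?thesis by (metis of_nat_le_iff of_nat_mult)
    qed
    then have "ln (real (n + 2)) \<le> ln (real n * real n)" using elim by (intro ln_mono) auto
    also have "\<dots> = 2 * ln (real n)" using elim by (simp add: ln_mult)
    finally have "ln (real (n + 2)) + 1 \<le> 3 * ln (real n)" using \<open>ln (real n) \<ge> 1\<close> by linarith
    also have "\<dots> \<le> \<kappa> * \<phi> n" using elim(1) \<open>ln (real n) \<ge> 1\<close> \<open>\<kappa> > 0\<close> by (simp add: field_simps)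
    finally show ?case .
  qed
qed

text \<open>A window set inside \<open>E_set \<phi>\<close> is built from the envelope. As
  \<open>m i\<close> governs the digit with index \<open>i + 1\<close>, \<open>window_bound\<close>
  is applied to \<open>p i = \<psi> (Suc i)\<close>.\<close>

lemma hausdorff_measure_E_set_pos:
  fixes \<phi> :: "nat \<Rightarrow> real"
  assumes pos: "\<And>n. n \<ge> 1 \<Longrightarrow> \<phi> n > 0" and mono: "mono_on {1..} \<phi>"
    and log: "filterlim (\<lambda>n. \<phi> n / ln (real n)) at_top sequentially"
    and b: "b > 1" and lim: "(\<lambda>n. \<phi> n / b ^ n) \<longlonglongrightarrow> 0"
    and s: "0 \<le> s" "s < 1 / (b + 1)"
  shows "hausdorff_measure s (E_set \<phi>) > 0"
proof -
  define \<psi> where "\<psi> = envelope b \<phi>"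
  have ge: "\<phi> n \<le> \<psi> n" and step: "\<psi> (Suc n) \<le> b * \<psi> n" and mono': "\<psi> n \<le> \<psi> (Suc n)"
    if "n \<ge> 1" for n
    unfolding \<psi>_def using envelope[OF pos mono b lim] that by auto
  have freq: "\<exists>\<^sub>F n in sequentially. \<psi> n = \<phi> n"
    unfolding \<psi>_def by (rule envelope_frequently_eq[OF pos mono b lim])
  define m where "m i = nat \<lfloor>exp (\<psi> (Suc i))\<rfloor>" for i
  have psi_pos: "\<psi> (Suc i) > 0" for i using pos[of "Suc i"] ge[of "Suc i"] by simp
  then have exp1: "exp (\<psi> (Suc i)) \<ge> 1" for i by (simp add: less_imp_le)
  have rm: "real (m i) = of_int \<lfloor>exp (\<psi> (Suc i))\<rfloor>" for i by (simp add: m_def)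
  have m1: "m i \<ge> 1" for i using exp1[of i] by (simp add: m_def le_nat_floor)
  have m_le: "ln (m i) \<le> \<psi> (Suc i)" for i
  proof -
    have "real (m i) \<le> exp (\<psi> (Suc i))" by (simp add: rm)
    then have "ln (m i) \<le> ln (exp (\<psi> (Suc i)))" using m1[of i] by (intro ln_mono) auto
    then show ?thesis by simp
  qed
  \<comment> \<open>Rounding down a number that is at least 1 loses at most half of it, and
    \<open>exp 1 >= 2\<close>.\<close>
  have m_ge: "\<psi> (Suc i) - 1 \<le> ln (m i)" for i
  proof -
    have "exp (\<psi> (Suc i) - 1) = exp (\<psi> (Suc i)) / exp 1" by (rule exp_diff)
    also have "\<dots> \<le> exp (\<psi> (Suc i)) / 2" using exp_ge_add_one_self[of 1] by (intro divide_left_mono) auto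
    also have "\<dots> \<le> real (m i)"
    proof -
      have "exp (\<psi> (Suc i)) < real (m i) + 1" unfolding rm by linarith
      then show ?thesis using m1[of i] by simp
    qed
    finally show ?thesis using m1[of i] by (simp add: ln_ge_iff)
  qed
  have ev: "eventually (\<lambda>n. ln (real (n + 2)) + 1 \<le> \<kappa> * \<psi> n) sequentially" if "\<kappa> > 0" for \<kappa>
    using eventually_ln_le[OF log that] eventually_ge_at_top[of 1]
  proof eventually_elim
    case (elim n)
    have "\<kappa> * \<phi> n \<le> \<kappa> * \<psi> n" using ge[OF elim(2)] that by simp
    with elim(1) show ?case by linarith
  qed
  have ev': "eventually (\<lambda>i. ln (real (i + 3)) + 1 \<le> \<kappa> * \<psi> (Suc i)) sequentially" if "\<kappa> > 0" for \<kappa>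
  proof -
    have "eventually (\<lambda>i. ln (real (Suc i + 2)) + 1 \<le> \<kappa> * \<psi> (Suc i)) sequentially"
      using ev[OF that] by (subst eventually_sequentially_Suc)
    then show ?thesis by (simp add: add.commute)
  qed
  have unbdd: "\<exists>i. m i \<ge> N" for N
  proof -
    obtain i where "\<And>j. j \<ge> i \<Longrightarrow> ln (real (j + 3)) + 1 \<le> 1 * \<psi> (Suc j)"
      using ev'[of 1] by (auto simp: eventually_sequentially)
    then have "ln (real (i + N + 3)) + 1 \<le> \<psi> (Suc (i + N))" by (metis le_add1 mult_1)
    then have "ln (real (i + N + 3)) \<le> ln (m (i + N))" using m_ge[of "i + N"] by linarith
    then have "real (i + N + 3) \<le> m (i + N)" using m1[of "i + N"] by (subst (asm) ln_le_cancel_iff) auto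
    then show ?thesis by (intro exI[of _ "i + N"]) linarith
  qed
  obtain C where C: "\<And>n. real (m n) powr (1 - s) * (\<Prod>i\<le>n. real ((i + 2) * m i)) powr (2 * s)
      \<le> C * (\<Prod>i\<le>n. real (m i))"
  proof (rule window_bound[of m "\<lambda>i. \<psi> (Suc i)" b s])
  qed (use m1 m_le m_ge step b s ev' in auto)
  have "(\<lambda>n. ln (real (n + 1)) / \<phi> n) \<longlonglongrightarrow> 0"
  proof (rule tendstoI)
    fix e :: real assume "e > 0"
    show "\<forall>\<^sub>F n in sequentially. dist (ln (real (n + 1)) / \<phi> n) 0 < e"
      using eventually_ln_le[OF log \<open>e > 0\<close>] eventually_ge_at_top[of 1]
    proof eventually_elim
      case (elim n)
      have "ln (real (n + 1)) \<le> ln (real (n + 2))" and nn: "0 \<le> ln (real (n + 1))" by auto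
      then have "ln (real (n + 1)) < e * \<phi> n" using elim(1) by linarith
      then show ?case using nn pos[OF elim(2)] by (simp add: dist_real_def divide_less_eq)
    qed
  qed
  then have sub: "window_set m \<subseteq> E_set \<phi>"
    unfolding m_def using window_set_subset_E_set[of \<phi> \<psi>] pos ge mono' freq by blast
  have "s \<le> 1" using s(2) b by (smt (verit) divide_le_eq_1)
  then have "0 < hausdorff_measure s (window_set m)"
    using hausdorff_measure_window_set_pos[OF m1 unbdd s(1) _ C] by simp
  also have "\<dots> \<le> hausdorff_measure s (E_set \<phi>)" by (intro hausdorff_measure_mono sub)
  finally show ?thesis .
qed

section \<open>The dimension as a limit of both bounds\<close>

theorem theorem2p6:
  fixes \<phi> :: "nat \<Rightarrow> real" and B :: ereal
  assumes "\<And>n. n \<ge> 1 \<Longrightarrow> \<phi> n > 0"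
    and "mono_on {1..} \<phi>"
    and "filterlim (\<lambda>n. \<phi> n / ln (real n)) at_top sequentially"
    and "1 \<le> B"
    and "ln_ereal B = limsup (\<lambda>n. ereal (ln (\<phi> n) / real n))"
  shows "hausdorff_dim (E_set \<phi>) = 1 / (B + 1)"
proof -
  have freq: "\<exists>\<^sub>F n in sequentially. b ^ n \<le> \<phi> n" if "1 < b" "ereal b < B" for b
  proof -
    have "ereal (ln b) < ln_ereal B"
      using that by (cases B) (auto simp: ln_ereal_def)
    then have "\<not> limsup (\<lambda>n. ereal (ln (\<phi> n) / real n)) \<le> ereal (ln b)"
      using assms(5) by (simp add: not_le)
    then have "\<not> (\<forall>\<^sub>F n in sequentially. ereal (ln (\<phi> n) / real n) \<le> ereal (ln b))"
      by (rule contrapos_nn) (rule Limsup_bounded)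
    then have "\<exists>\<^sub>F n in sequentially. ln b < ln (\<phi> n) / real n"
      by (simp add: frequently_def not_less)
    \<comment> \<open>At \<open>n = 0\<close> the quotient is only a default value and
      \<open>\<phi> n\<close> need not be positive.\<close>
    then have "\<exists>\<^sub>F n in sequentially. ln b < ln (\<phi> n) / real n \<and> n \<ge> 1"
      using eventually_ge_at_top by (rule frequently_eventually_frequently)
    then show ?thesis
    proof (rule frequently_elim1)
      fix n assume "ln b < ln (\<phi> n) / real n \<and> n \<ge> 1"
      then have n: "ln b < ln (\<phi> n) / real n" "n \<ge> 1" by auto
      then have "ln (b ^ n) < ln (\<phi> n)" using that(1) by (simp add: ln_realpow less_divide_eq mult.commute)
      then show "b ^ n \<le> \<phi> n" using that(1) assms(1)[of n] n by simp
    qed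
  qed
  have upper: "hausdorff_dim (E_set \<phi>) \<le> ereal (1 / (c + 1))" if "c = 1 \<or> 1 < c \<and> ereal c < B" for c
  proof (rule hausdorff_dim_leI)
    show "0 \<le> 1 / (c + 1)" using that by auto
    fix s assume s: "1 / (c + 1) < s"
    show "hausdorff_measure s (E_set \<phi>) = 0"
    proof (cases "c = 1")
      case True
      then show ?thesis using hausdorff_measure_E_set_eq_0[of \<phi> c _ s, OF assms(1) _ s] by blast
    next
      case False
      then have "ereal c < B" using \<open>c = 1 \<or> 1 < c \<and> ereal c < B\<close> by blast
      then obtain b where b: "ereal c < ereal b" "ereal b < B" using ereal_dense2 by blast
      have "1 < c" using False \<open>c = 1 \<or> 1 < c \<and> ereal c < B\<close> by blast
      then have "1 < c \<and> c < b \<and> (\<exists>\<^sub>F n in sequentially. b ^ n \<le> \<phi> n)"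
        using b freq[of b] by auto
      then show ?thesis using hausdorff_measure_E_set_eq_0[of \<phi> c _ s, OF assms(1) _ s] by blast
    qed
  qed
  show ?thesis
  proof (cases B)
    case (real \<beta>)
    then have "\<beta> \<ge> 1" using assms(4) by (simp add: one_ereal_def)
    have "ereal (1 / (\<beta> + 1)) \<le> hausdorff_dim (E_set \<phi>)"
    proof (rule hausdorff_dim_geI)
      fix s :: real assume s: "0 \<le> s" "s < 1 / (\<beta> + 1)"
      have "((\<lambda>b. 1 / (b + 1)) \<longlongrightarrow> 1 / (\<beta> + 1)) (at_right \<beta>)"
        using \<open>\<beta> \<ge> 1\<close> by (intro tendsto_intros) auto
      then have "\<forall>\<^sub>F b in at_right \<beta>. s < 1 / (b + 1)"
        using s(2) by (rule order_tendstoD)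
      then obtain b where b: "\<beta> < b" "s < 1 / (b + 1)"
        using eventually_happens'[OF _ eventually_conj[OF eventually_at_right_less]] trivial_limit_at_right_real by blast
      \<comment> \<open>The intermediate \<open>d\<close> gives \<open>\<phi> n < d^n\<close>
        eventually, so that \<open>\<phi> n / b^n\<close> is dominated by the null sequence
        \<open>(d / b)^n\<close>.\<close>
      obtain d where d: "\<beta> < d" "d < b" using dense b(1) by blast
      have "limsup (\<lambda>n. ereal (ln (\<phi> n) / real n)) < ereal (ln d)"
        unfolding assms(5)[symmetric] using real \<open>\<beta> \<ge> 1\<close> d by (simp add: ln_ereal_def)
      then have "\<forall>\<^sub>F n in sequentially. ereal (ln (\<phi> n) / real n) < ereal (ln d)"
        by (rule Limsup_lessD)
      then have le: "\<forall>\<^sub>F n in sequentially. norm (\<phi> n / b ^ n) \<le> (d / b) ^ n"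
        using eventually_ge_at_top[of 1]
      proof eventually_elim
        case (elim n)
        then have "ln (\<phi> n) < ln (d ^ n)" using d \<open>\<beta> \<ge> 1\<close> by (simp add: ln_realpow field_simps)
        then have "\<phi> n < d ^ n" using assms(1)[OF elim(2)] d \<open>\<beta> \<ge> 1\<close> by simp
        then show ?case
          using assms(1)[OF elim(2)] d \<open>\<beta> \<ge> 1\<close> by (simp add: power_divide divide_right_mono)
      qed
      have "(\<lambda>n. \<phi> n / b ^ n) \<longlonglongrightarrow> 0"
        using d \<open>\<beta> \<ge> 1\<close> by (intro Lim_null_comparison[OF le] LIMSEQ_realpow_zero) auto
      then have "hausdorff_measure s (E_set \<phi>) > 0"
        using b \<open>\<beta> \<ge> 1\<close> s by (intro hausdorff_measure_E_set_pos assms) auto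
      then show "hausdorff_measure s (E_set \<phi>) \<noteq> 0" by simp
    qed
    \<comment> \<open>For \<open>\<beta> = 1\<close> there is no \<open>c\<close> with
      \<open>1 < c < \<beta>\<close>, so \<open>c = 1\<close> is taken directly; otherwise
      \<open>c\<close> tends to \<open>\<beta>\<close> from below.\<close>
    moreover have "hausdorff_dim (E_set \<phi>) \<le> ereal (1 / (\<beta> + 1))"
    proof (cases "\<beta> = 1")
      case True
      then show ?thesis using upper[of 1] by simp
    next
      case False
      have "((\<lambda>c. ereal (1 / (c + 1))) \<longlongrightarrow> ereal (1 / (\<beta> + 1))) (at_left \<beta>)"
        using \<open>\<beta> \<ge> 1\<close> by (intro tendsto_intros) auto
      moreover have "\<forall>\<^sub>F c in at_left \<beta>. hausdorff_dim (E_set \<phi>) \<le> ereal (1 / (c + 1))"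
        unfolding eventually_at_left_field
        using False \<open>\<beta> \<ge> 1\<close> real upper by (intro exI[of _ 1]) auto
      ultimately show ?thesis by (rule tendsto_lowerbound) simp
    qed
    moreover have "1 / (B + 1) = ereal (1 / (\<beta> + 1))"
      using real \<open>\<beta> \<ge> 1\<close> by (simp add: one_ereal_def)
    ultimately show ?thesis by (simp add: antisym)
  next
    case PInf
    have "filterlim (\<lambda>c::real. 1 + c) at_top at_top"
      by (rule filterlim_tendsto_add_at_top[OF tendsto_const filterlim_ident])
    then have "((\<lambda>c::real. 1 / (1 + c)) \<longlongrightarrow> 0) at_top"
      using tendsto_divide_0[OF tendsto_const filterlim_at_top_imp_at_infinity] by blast
    then have "((\<lambda>c. ereal (1 / (c + 1))) \<longlongrightarrow> ereal 0) at_top"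
      by (intro tendsto_ereal) (simp add: add.commute)
    moreover have "\<forall>\<^sub>F c in at_top. hausdorff_dim (E_set \<phi>) \<le> ereal (1 / (c + 1))"
      using eventually_gt_at_top[of 1] by (rule eventually_mono) (use PInf upper in auto)
    ultimately have "hausdorff_dim (E_set \<phi>) \<le> ereal 0" by (rule tendsto_lowerbound) simp
    then have "hausdorff_dim (E_set \<phi>) = 0"
      using hausdorff_dim_nonneg[of "E_set \<phi>"] by (intro antisym) (simp_all add: zero_ereal_def)
    then show ?thesis using PInf by simp
  qed (use assms(4) in auto)
qed

end
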